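(* Let $X$ be an infinite-dimensional complex Banach space and let $T\in\mathcal{B}(X)$. The following statements are equivalent: (i) $T$ is essentially right Drazin invertible. (ii) $d_e(T)<\infty$ and $\mathcal{N}(T^n)$ and $\mathcal{R}(T^n)$ are topologically complemented for every $n\ge d_e(T)$. (iii) $d_e(T)<\infty$ and there exists $n\ge d_e(T)$ such that $\mathcal{N}(T^{n+1})$ and $\mathcal{R}(T^n)$ are topologically complemented.
   Context: $\mathcal{B}(X)$ is the algebra of bounded linear operators on $X$; $\mathcal{N}(T)$, $\mathcal{R}(T)$ denote kernel and range; $\mathbb{N}_0=\{0,1,2,\dots\}$, $\mathbb{N}=\{1,2,\dots\}$; the infimum of the empty set is $\infty$. A subspace of $X$ is topologically complemented if it is closed and has a closed algebraic complement in $X$. The essential descent $d_e(T)$ is the smallest $n\in\mathbb{N}_0$ with $\operatorname{codim}(\mathcal{R}(T)+\mathcal{N}(T^n))<\infty$ ($\infty$ if there is none). The degree of stable iteration is $\operatorname{dis}(T)=\inf\{n\in\mathbb{N}_0: m\ge n,\ m\in\mathbb{N}\Rightarrow \mathcal{N}(T)\cap\mathcal{R}(T^n)=\mathcal{N}(T)\cap\mathcal{R}(T^m)\}$. $T$ is essentially right Drazin invertible if $d_e(T)<\infty$ and $\mathcal{N}(T)\cap\mathcal{R}(T^{\operatorname{dis}(T)})$ is topologically complemented in $X$. *)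

theory Defs
  imports "HOL-Analysis.Analysis"
begin

text \<open>A complex Banach space is a real Banach space with a complex scalar multiplication that
  extends the real one and for which the norm is homogeneous.\<close>

class complex_banach = banach +
  fixes scaleC :: "complex \<Rightarrow> 'a \<Rightarrow> 'a"  (infixr "*\<^sub>C" 75)
  assumes scaleC_add_right: "c *\<^sub>C (x + y) = c *\<^sub>C x + c *\<^sub>C y"
    and scaleC_add_left: "(c + d) *\<^sub>C x = c *\<^sub>C x + d *\<^sub>C x"
    and scaleC_scaleC: "c *\<^sub>C d *\<^sub>C x = (c * d) *\<^sub>C x"
    and scaleC_of_real: "complex_of_real r *\<^sub>C x = r *\<^sub>R x"
    and norm_scaleC: "norm (c *\<^sub>C x) = cmod c * norm x"

global_interpretation complex_vector: vector_space "scaleC :: complex \<Rightarrow> 'a \<Rightarrow> 'a::complex_banach"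
  defines csubspace = complex_vector.subspace
    and cspan = complex_vector.span
proof
  show "1 *\<^sub>C x = x" for x :: 'a
    using scaleC_of_real[of 1 x] by simp
qed (simp_all add: scaleC_add_right scaleC_add_left scaleC_scaleC)

definition infinite_cdim :: "'a::complex_banach itself \<Rightarrow> bool"
  where "infinite_cdim _ \<longleftrightarrow> \<not> (\<exists>B::'a set. finite B \<and> cspan B = UNIV)"

definition bounded_clinear :: "('a::complex_banach \<Rightarrow> 'a) \<Rightarrow> bool"
  where "bounded_clinear T \<longleftrightarrow>
    Vector_Spaces.linear scaleC scaleC T \<and> (\<exists>K. \<forall>x. norm (T x) \<le> K * norm x)"

definition kernel :: "('a::complex_banach \<Rightarrow> 'a) \<Rightarrow> 'a set"
  where "kernel T = {x. T x = 0}"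

definition topologically_complemented :: "'a::complex_banach set \<Rightarrow> bool"
  where "topologically_complemented M \<longleftrightarrow> csubspace M \<and> closed M \<and>
    (\<exists>N. csubspace N \<and> closed N \<and> M \<inter> N = {0} \<and> M + N = UNIV)"

text \<open>The codimension of \<open>M\<close> is the dimension of the quotient \<open>X/M\<close>, that is, the least number of
  vectors whose cosets span \<open>X/M\<close>; it is \<open>\<infinity>\<close> (the infimum of the empty set) if there is no finite
  set of such vectors.\<close>

definition codim :: "'a::complex_banach set \<Rightarrow> enat"
  where "codim M = Inf {enat (card B) |B. finite B \<and> (\<forall>x. \<exists>y\<in>cspan B. x - y \<in> M)}"

definition essential_descent :: "('a::complex_banach \<Rightarrow> 'a) \<Rightarrow> enat"
  where "essential_descent T = Inf {enat n |n. codim (range T + kernel (T ^^ n)) < \<infinity>}"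

definition dis :: "('a::complex_banach \<Rightarrow> 'a) \<Rightarrow> enat"
  where "dis T = Inf {enat n |n. \<forall>m. m \<ge> n \<and> m \<ge> 1 \<longrightarrow>
    kernel T \<inter> range (T ^^ n) = kernel T \<inter> range (T ^^ m)}"

text \<open>The set \<open>R(T\<^bsup>dis T\<^esup>)\<close> only makes sense for finite \<open>dis T\<close>, which is made explicit here. It is no
  additional restriction: finite essential descent implies that the subspaces
  \<open>R(T) + N(T\<^bsup>n\<^esup>)\<close> are eventually constant, which is equivalent to the stabilisation of
  \<open>N(T) \<inter> R(T\<^bsup>n\<^esup>)\<close>.\<close>

definition essentially_right_Drazin_invertible :: "('a::complex_banach \<Rightarrow> 'a) \<Rightarrow> bool"
  where "essentially_right_Drazin_invertible T \<longleftrightarrow> essential_descent T < \<infinity> \<and>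
    (\<exists>k. dis T = enat k \<and> topologically_complemented (kernel T \<inter> range (T ^^ k)))"

end

theory Submission
  imports Defs
begin

text \<open>
  Write \<open>A\<^sub>m = N(T) \<inter> R(T\<^bsup>m\<^esup>)\<close> and \<open>d\<close> for the essential descent. The main obstacle is topological: the
  subspaces in question are images and sums of closed subspaces, and nothing guarantees that they
  are closed. All of them are operator ranges, however, and two operator ranges that are algebraic
  complements of each other are automatically closed, by the open mapping theorem
  (\<open>closed_if_complementary_operator_ranges\<close>). So a subspace is topologically complemented if and only
  if it is an operator range with an algebraic complement that is an operator range
  (\<open>topologically_complemented_iff\<close>). As operator ranges are stable under sums, intersections, images
  and preimages, the theorem turns into linear algebra with explicit complements.

  Finite codimension of \<open>R(T) + N(T\<^bsup>d\<^esup>)\<close> has two consequences. First, the decreasing subspaces \<open>A\<^sub>m\<close>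
  with \<open>m \<ge> d\<close> differ by finite dimensions and become constant, so \<open>dis T\<close> is finite, and \<open>A\<^sub>m\<close> is
  complemented for one \<open>m\<close> among \<open>dis T\<close> and the numbers \<open>m \<ge> d\<close> if and only if it is so for all of
  them (\<open>kernel_Int_range_complementary_transfer\<close>). Passing from a complemented subspace to a finite
  extension requires the Hahn-Banach theorem; the other direction is algebraic. Second,
  \<open>R(T\<^bsup>n\<^esup>) + N(T\<^bsup>n\<^esup>)\<close> has finite codimension for \<open>n \<ge> d\<close>.

  If all \<open>A\<^sub>m\<close> with \<open>m \<ge> d\<close> are complemented, so is \<open>N(T\<^bsup>j\<^esup>) \<inter> R(T\<^bsup>m\<^esup>)\<close>, by induction on \<open>j\<close>
  (\<open>kernel_power_Int_range_complementary\<close>). For \<open>j = m = n\<close> this is the intersection of \<open>N(T\<^bsup>n\<^esup>)\<close> and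
  \<open>R(T\<^bsup>n\<^esup>)\<close>; since their sum has finite codimension, both are complemented
  (\<open>complementary_if_Int_complementary\<close>), which is (ii). Statement (iii) is an instance of (ii).
  Finally, complements of \<open>N(T\<^bsup>n+1\<^esup>)\<close> and \<open>R(T\<^bsup>n\<^esup>)\<close> provide one of \<open>A\<^sub>n\<close> because \<open>A\<^sub>n\<close> is the image
  of \<open>N(T\<^bsup>n+1\<^esup>)\<close> under \<open>T\<^bsup>n\<^esup>\<close> (\<open>kernel_Int_range_complementary\<close>), and hence a complement of \<open>A\<^sub>m\<close> for
  \<open>m = dis T\<close>, which is (i).
\<close>

section \<open>Operator ranges and the open mapping principle\<close>

text \<open>Operator ranges, the images of Banach spaces under bounded operators, are usually handled through
  the complete norm that they inherit. A quotient norm is an infimum, and a single type of Banach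
  spaces cannot accommodate all the spaces that may parametrise a range. Both problems disappear
  with a relation \<open>G x r\<close> in place of a norm: \<open>x\<close> can be reached at cost \<open>r\<close>. Completeness becomes
  countable additivity: a sequence of elements with summable costs has its sum in the range, at the
  total cost.\<close>

definition complete_cost :: "('a::banach \<Rightarrow> real \<Rightarrow> bool) \<Rightarrow> bool"
  where "complete_cost G \<longleftrightarrow>
    (\<forall>x r. G x r \<longrightarrow> norm x \<le> r) \<and>
    (\<forall>c x r. G x r \<longrightarrow> G (c *\<^sub>R x) (\<bar>c\<bar> * r)) \<and>
    (\<forall>x r. (\<forall>n::nat. G (x n) (r n)) \<and> summable r \<longrightarrow> G (suminf x) (suminf r))"

definition operator_range :: "'a::banach set \<Rightarrow> bool"
  where "operator_range M \<longleftrightarrow> (\<exists>G. complete_cost G \<and> M = {x. \<exists>r. G x r})"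

lemma complete_cost_norm: "complete_cost G \<Longrightarrow> G x r \<Longrightarrow> norm x \<le> r"
  and complete_cost_scale: "complete_cost G \<Longrightarrow> G x r \<Longrightarrow> G (c *\<^sub>R x) (\<bar>c\<bar> * r)"
  and complete_cost_suminf:
    "complete_cost G \<Longrightarrow> (\<And>n. G (f n) (s n)) \<Longrightarrow> summable s \<Longrightarrow> G (suminf f) (suminf s)"
  by (auto simp: complete_cost_def)

lemma complete_cost_nonneg: "complete_cost G \<Longrightarrow> G x r \<Longrightarrow> 0 \<le> r"
  using complete_cost_norm norm_ge_zero order_trans by blast

lemma complete_cost_summable:
  "complete_cost G \<Longrightarrow> (\<And>n. G (f n) (s n)) \<Longrightarrow> summable s \<Longrightarrow> summable f"
  using complete_cost_norm by (metis summable_comparison_test')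

lemma complete_cost_zero: "complete_cost G \<Longrightarrow> G x r \<Longrightarrow> G 0 0"
  using complete_cost_scale[of G x r 0] by simp

lemma complete_cost_add:
  assumes G: "complete_cost G" and x: "G x r" and y: "G y s"
  shows "G (x + y) (r + s)"
proof -
  let ?f = "\<lambda>n::nat. if n = 0 then x else if n = 1 then y else 0"
  let ?r = "\<lambda>n::nat. if n = 0 then r else if n = 1 then s else 0"
  have "?f sums (\<Sum>n\<in>{0,1}. ?f n)" "?r sums (\<Sum>n\<in>{0,1}. ?r n)"
    by (rule sums_finite; auto)+
  then have f: "?f sums (x + y)" and r: "?r sums (r + s)"
    by simp_all
  have "G (suminf ?f) (suminf ?r)"
    using G
  proof (rule complete_cost_suminf)
    show "G (?f n) (?r n)" for n
      using x y complete_cost_zero[OF G x] by simp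
    show "summable ?r" using r by (rule sums_summable)
  qed
  then show ?thesis
    using f r by (simp add: sums_iff)
qed

lemma complete_cost_diff:
  assumes "complete_cost G" "G x r" "G y s"
  shows "G (x - y) (r + s)"
  using complete_cost_add[OF assms(1,2) complete_cost_scale[OF assms(1,3), of "-1"]] by simp

lemma operator_range_closed_subspace:
  assumes "closed M" "subspace M"
  shows "operator_range M"
  unfolding operator_range_def
proof (intro exI conjI)
  let ?G = "\<lambda>x r. x \<in> M \<and> norm x \<le> r"
  show "M = {x. \<exists>r. ?G x r}" by auto
  show "complete_cost ?G"
    unfolding complete_cost_def
  proof (intro conjI allI impI; (elim conjE)?)
    fix f :: "nat \<Rightarrow> 'a" and s
    assume f: "\<forall>n. f n \<in> M \<and> norm (f n) \<le> s n" and s: "summable s"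
    have sn: "summable (\<lambda>n. norm (f n))"
      by (rule summable_comparison_test'[OF s, of 0]) (simp add: f)
    have "f sums suminf f"
      using summable_sums[OF summable_norm_cancel[OF sn]] .
    then have lim: "(\<lambda>k. \<Sum>n<k. f n) \<longlonglongrightarrow> suminf f"
      unfolding sums_def .
    have "(\<Sum>n<k. f n) \<in> M" for k
      using f assms(2) by (simp add: subspace_sum)
    then show "suminf f \<in> M"
      using closed_sequentially[OF assms(1) _ lim] by simp
    have "norm (suminf f) \<le> (\<Sum>n. norm (f n))"
      using sn by (rule summable_norm)
    also have "\<dots> \<le> suminf s"
      using f s sn by (intro suminf_le) auto
    finally show "norm (suminf f) \<le> suminf s" .
  qed (use assms(2) in \<open>auto simp: subspace_scale intro: mult_left_mono\<close>)
qed

text \<open>The cost of a point of the image is the cost of any of its preimages, scaled so that it dominates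
  the norm. No infimum over preimages is taken: that is the benefit of a cost relation.\<close>

lemma operator_range_image:
  assumes T: "bounded_linear T" and M: "operator_range M"
  shows "operator_range (T ` M)"
proof -
  interpret bounded_linear T by fact
  obtain K where K: "K > 0" "\<And>x. norm (T x) \<le> norm x * K"
    using pos_bounded by blast
  obtain G where G: "complete_cost G" and M: "M = {x. \<exists>r. G x r}"
    using M unfolding operator_range_def by blast
  let ?H = "\<lambda>y t. \<exists>x r. G x r \<and> y = T x \<and> t = r * K"
  have "complete_cost ?H"
    unfolding complete_cost_def
  proof (intro conjI allI impI; (elim conjE)?)
    show "norm y \<le> t" if "?H y t" for y t
      using that K complete_cost_norm[OF G] by (smt (verit) mult_right_mono)
    show "?H (c *\<^sub>R y) (\<bar>c\<bar> * t)" if "?H y t" for c y t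
      using that complete_cost_scale[OF G] by (metis scale mult.assoc)
    fix y :: "nat \<Rightarrow> 'b" and t
    assume "\<forall>n. ?H (y n) (t n)" and t: "summable t"
    then obtain x r where x: "\<And>n. G (x n) (r n)" and y: "\<And>n. y n = T (x n)"
      and tr: "\<And>n. t n = r n * K"
      by metis
    have "y = (\<lambda>n. T (x n))" "t = (\<lambda>n. r n * K)"
      using y tr by auto
    moreover have r: "summable r"
      using summable_divide[OF t, of K] K(1) by (simp add: tr)
    moreover have "summable x"
      using complete_cost_summable[OF G x r] .
    ultimately show "?H (suminf y) (suminf t)"
      using complete_cost_suminf[OF G x r] suminf by (metis suminf_mult2)
  qed
  moreover have "T ` M = {y. \<exists>t. ?H y t}"
    unfolding M by auto
  ultimately show ?thesis
    unfolding operator_range_def by blast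
qed

lemma operator_range_vimage:
  assumes T: "bounded_linear T" and M: "operator_range M"
  shows "operator_range (T -` M)"
proof -
  interpret bounded_linear T by fact
  obtain G where G: "complete_cost G" and M: "M = {x. \<exists>r. G x r}"
    using M unfolding operator_range_def by blast
  let ?H = "\<lambda>x t. \<exists>r s. norm x \<le> r \<and> G (T x) s \<and> t = r + s"
  have "complete_cost ?H"
    unfolding complete_cost_def
  proof (intro conjI allI impI; (elim conjE)?)
    show "norm x \<le> t" if "?H x t" for x t
      using that complete_cost_nonneg[OF G] by fastforce
    show "?H (c *\<^sub>R x) (\<bar>c\<bar> * t)" if xt: "?H x t" for c x t
    proof -
      obtain r s where rs: "norm x \<le> r" "G (T x) s" "t = r + s"
        using xt by blast
      have "norm (c *\<^sub>R x) \<le> \<bar>c\<bar> * r" "G (T (c *\<^sub>R x)) (\<bar>c\<bar> * s)" "\<bar>c\<bar> * t = \<bar>c\<bar> * r + \<bar>c\<bar> * s"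
        using rs complete_cost_scale[OF G rs(2), of c]
        by (auto simp: scale distrib_left intro: mult_left_mono)
      then show ?thesis by blast
    qed
    fix x :: "nat \<Rightarrow> 'a" and t
    assume "\<forall>n. ?H (x n) (t n)" and t: "summable t"
    then obtain r s where r: "\<And>n. norm (x n) \<le> r n" and s: "\<And>n. G (T (x n)) (s n)"
      and trs: "\<And>n. t n = r n + s n"
      by metis
    have s0: "0 \<le> s n" and r0: "0 \<le> r n" for n
      using complete_cost_nonneg[OF G s] order_trans[OF norm_ge_zero r] by blast+
    have sr: "summable r"
      using r0 s0 trs by (intro summable_comparison_test'[OF t, of 0]) auto
    have ss: "summable s"
      using r0 s0 trs by (intro summable_comparison_test'[OF t, of 0]) auto
    have xn: "summable (\<lambda>n. norm (x n))"
      using r by (intro summable_comparison_test'[OF sr, of 0]) auto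
    have "norm (suminf x) \<le> suminf r"
      using summable_norm[OF xn] suminf_le[OF r xn sr] by linarith
    moreover have "G (T (suminf x)) (suminf s)"
      using complete_cost_suminf[OF G s ss] suminf[OF summable_norm_cancel[OF xn]] by simp
    moreover have "suminf t = suminf r + suminf s"
      using suminf_add[OF sr ss] trs by presburger
    ultimately show "?H (suminf x) (suminf t)" by blast
  qed
  moreover have "T -` M = {y. \<exists>t. ?H y t}"
    unfolding M by auto
  ultimately show ?thesis
    unfolding operator_range_def by blast
qed

lemma complete_cost_plus:
  assumes G: "complete_cost G" and H: "complete_cost H"
  shows "complete_cost (\<lambda>z t. \<exists>x y r s. G x r \<and> H y s \<and> z = x + y \<and> t = r + s)"
    (is "complete_cost ?S")
  unfolding complete_cost_def
proof (intro conjI allI impI; (elim conjE)?)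
  show "norm z \<le> t" if "?S z t" for z t
    using that complete_cost_norm[OF G] complete_cost_norm[OF H] norm_triangle_mono by blast
  show "?S (c *\<^sub>R z) (\<bar>c\<bar> * t)" if "?S z t" for c z t
    using that complete_cost_scale[OF G, of _ _ c] complete_cost_scale[OF H, of _ _ c]
    by (metis scaleR_right_distrib distrib_left)
  fix z :: "nat \<Rightarrow> 'a" and t
  assume "\<forall>n. ?S (z n) (t n)" and t: "summable t"
  then obtain x y r s where r: "\<And>n. G (x n) (r n)" and s: "\<And>n. H (y n) (s n)"
    and z: "\<And>n. z n = x n + y n" and trs: "\<And>n. t n = r n + s n"
    by metis
  note nonneg = complete_cost_nonneg[OF G r] complete_cost_nonneg[OF H s]
  have sr: "summable r" and ss: "summable s"
    using nonneg trs by (auto intro!: summable_comparison_test'[OF t, of 0])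
  have "suminf t = suminf r + suminf s"
    using suminf_add[OF sr ss] trs by presburger
  moreover have "suminf z = suminf x + suminf y"
    using suminf_add[OF complete_cost_summable[OF G r sr] complete_cost_summable[OF H s ss]] z
    by presburger
  ultimately show "?S (suminf z) (suminf t)"
    using complete_cost_suminf[OF G r sr] complete_cost_suminf[OF H s ss] by blast
qed

lemma operator_range_plus:
  assumes "operator_range M" "operator_range N"
  shows "operator_range (M + N)"
proof -
  obtain G H where "complete_cost G" "complete_cost H"
    and MN: "M = {x. \<exists>r. G x r}" "N = {x. \<exists>r. H x r}"
    using assms unfolding operator_range_def by blast
  moreover have "M + N = {z. \<exists>t. \<exists>x y r s. G x r \<and> H y s \<and> z = x + y \<and> t = r + s}"
    unfolding MN set_plus_def by blast
  ultimately show ?thesis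
    unfolding operator_range_def using complete_cost_plus by blast
qed

lemma operator_range_Int:
  assumes "operator_range M" "operator_range N"
  shows "operator_range (M \<inter> N)"
proof -
  obtain G H where G: "complete_cost G" and H: "complete_cost H"
    and MN: "M = {x. \<exists>r. G x r}" "N = {x. \<exists>r. H x r}"
    using assms unfolding operator_range_def by blast
  let ?I = "\<lambda>x t. \<exists>r s. G x r \<and> H x s \<and> t = r + s"
  have "complete_cost ?I"
    unfolding complete_cost_def
  proof (intro conjI allI impI; (elim conjE)?)
    show "norm x \<le> t" if "?I x t" for x t
      using that complete_cost_norm[OF G] complete_cost_nonneg[OF H] by fastforce
    show "?I (c *\<^sub>R x) (\<bar>c\<bar> * t)" if "?I x t" for c x t
      using that complete_cost_scale[OF G, of _ _ c] complete_cost_scale[OF H, of _ _ c]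
      by (metis distrib_left)
    fix x :: "nat \<Rightarrow> 'a" and t
    assume "\<forall>n. ?I (x n) (t n)" and t: "summable t"
    then obtain r s where r: "\<And>n. G (x n) (r n)" and s: "\<And>n. H (x n) (s n)"
      and trs: "\<And>n. t n = r n + s n"
      by metis
    note nonneg = complete_cost_nonneg[OF G r] complete_cost_nonneg[OF H s]
    have sr: "summable r" and ss: "summable s"
      using nonneg trs by (auto intro!: summable_comparison_test'[OF t, of 0])
    have "suminf t = suminf r + suminf s"
      using suminf_add[OF sr ss] trs by presburger
    then show "?I (suminf x) (suminf t)"
      using complete_cost_suminf[OF G r sr] complete_cost_suminf[OF H s ss] by blast
  qed
  moreover have "M \<inter> N = {x. \<exists>t. ?I x t}"
    unfolding MN by auto
  ultimately show ?thesis
    unfolding operator_range_def by blast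
qed

text \<open>The Baire category half of the open mapping theorem: the points of cost at most \<open>n\<close> are dense in
  some ball. Differences move that ball to the origin, and homogeneity spreads the estimate to all
  of the space.\<close>

lemma cost_approximation:
  fixes G :: "'a::banach \<Rightarrow> real \<Rightarrow> bool"
  assumes G: "complete_cost G" and total: "\<And>x. \<exists>r. G x r"
  obtains K where "K > 0"
    "\<And>z \<delta>. \<delta> > 0 \<Longrightarrow> \<exists>a r. G a r \<and> r \<le> K * norm z \<and> norm (z - a) < \<delta>"
proof -
  define D where "D n = {x. \<exists>r \<le> real n. G x r}" for n :: nat
  have cover: "(\<Union>n. closure (D n)) = UNIV"
  proof -
    have "x \<in> (\<Union>n. closure (D n))" for x
    proof -
      obtain r where "G x r" using total by blast
      moreover obtain n :: nat where "r \<le> real n" using real_arch_simple by blast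
      ultimately have "x \<in> D n" unfolding D_def by blast
      then show ?thesis using closure_subset by blast
    qed
    then show ?thesis by blast
  qed
  have "\<exists>n. interior (closure (D n)) \<noteq> {}"
  proof (rule ccontr)
    assume "\<nexists>n. interior (closure (D n)) \<noteq> {}"
    then have "euclidean interior_of \<Union> (range (\<lambda>n. closure (D n))) = ({}::'a set)"
      by (intro Baire_category_alt) (auto simp: completely_metrizable_space_euclidean)
    then show False using cover by simp
  qed
  then obtain n x0 where "x0 \<in> interior (closure (D n))" by blast
  then obtain e where e: "e > 0" "ball x0 e \<subseteq> closure (D n)"
    using mem_interior by blast
  \<comment> \<open>Half the difference of approximations to \<open>x0 + z\<close> and \<open>x0 - z\<close> approximates \<open>z\<close>.\<close>
  have near: "\<exists>a\<in>D n. norm (z - a) < \<delta>" if z: "norm z < e" and \<delta>: "\<delta> > 0" for z \<delta>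
  proof -
    have "x0 + z \<in> closure (D n)" "x0 - z \<in> closure (D n)"
      using z e(2) by (auto simp: dist_norm subset_iff)
    then obtain a b where ab: "a \<in> D n" "dist a (x0 + z) < \<delta>" "b \<in> D n" "dist b (x0 - z) < \<delta>"
      using \<delta> unfolding closure_approachable by blast
    then obtain r s where rs: "G a r" "r \<le> n" "G b s" "s \<le> n"
      unfolding D_def by blast
    have "G ((1/2) *\<^sub>R (a - b)) ((r + s) / 2)"
      using complete_cost_scale[OF G complete_cost_diff[OF G rs(1,3)], of "1/2"] by simp
    moreover have "(r + s) / 2 \<le> n" using rs by simp
    ultimately have "(1/2) *\<^sub>R (a - b) \<in> D n"
      unfolding D_def by blast
    moreover have "norm (z - (1/2) *\<^sub>R (a - b)) < \<delta>"
    proof -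
      have "z - (1/2) *\<^sub>R (a - b) = (1/2) *\<^sub>R ((x0 + z - a) - (x0 - z - b))"
        by (simp add: algebra_simps flip: scaleR_left.add)
      then have "norm (z - (1/2) *\<^sub>R (a - b)) \<le> (norm (x0 + z - a) + norm (x0 - z - b)) / 2"
        using norm_triangle_ineq4[of "x0 + z - a" "x0 - z - b"] by simp
      then show ?thesis
        using ab by (simp add: dist_norm norm_minus_commute)
    qed
    ultimately show ?thesis by blast
  qed
  define K where "K = 2 * (real n + 1) / e"
  have "\<exists>a r. G a r \<and> r \<le> K * norm z \<and> norm (z - a) < \<delta>" if \<delta>: "\<delta> > 0" for z \<delta>
  proof (cases "z = 0")
    case True
    have "G 0 0" using total complete_cost_zero[OF G] by blast
    then show ?thesis using True \<delta> by force
  next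
    case False
    define c where "c = e / (2 * norm z)"
    have c: "c > 0" "norm (c *\<^sub>R z) < e" "inverse c = 2 * norm z / e"
      using e(1) False by (auto simp: c_def field_simps)
    obtain a where a: "a \<in> D n" "norm (c *\<^sub>R z - a) < c * \<delta>"
      using near[OF c(2), of "c * \<delta>"] c(1) \<delta> by auto
    then obtain r where r: "G a r" "r \<le> n" unfolding D_def by blast
    have "G (inverse c *\<^sub>R a) (inverse c * r)"
      using complete_cost_scale[OF G r(1), of "inverse c"] c(1) by simp
    moreover have "inverse c * r \<le> K * norm z"
    proof -
      have "inverse c * r \<le> inverse c * (real n + 1)"
        using c(1) r(2) by (intro mult_left_mono) auto
      then show ?thesis by (simp add: K_def c(3) algebra_simps)
    qed
    moreover have "norm (z - inverse c *\<^sub>R a) < \<delta>"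
    proof -
      have "c *\<^sub>R (z - inverse c *\<^sub>R a) = c *\<^sub>R z - a"
        using c(1) by (simp add: scaleR_diff_right)
      then have "c * norm (z - inverse c *\<^sub>R a) = norm (c *\<^sub>R z - a)"
        using c(1) by (metis abs_of_pos norm_scaleR)
      then show ?thesis using a(2) c(1) by (metis mult_less_cancel_left_pos)
    qed
    ultimately show ?thesis by blast
  qed
  moreover have "K > 0" using e(1) by (simp add: K_def)
  ultimately show thesis using that by blast
qed

text \<open>If every point of a Banach space has a cost, the costs can be chosen proportional to the norm
  (Zabreiko's lemma, and the open mapping theorem for quotient norms). The approximations of the
  preceding lemma are iterated on the remainders, whose norms decay geometrically, and countable
  additivity collects them into an exact representation.\<close>

lemma complete_cost_bounded:
  fixes G :: "'a::banach \<Rightarrow> real \<Rightarrow> bool"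
  assumes G: "complete_cost G" and total: "\<And>x. \<exists>r. G x r"
  obtains C where "\<And>z. \<exists>r. G z r \<and> r \<le> C * norm z"
proof -
  obtain K where K: "K > 0"
    and approx: "\<And>z \<delta>. \<delta> > 0 \<Longrightarrow> \<exists>a r. G a r \<and> r \<le> K * norm z \<and> norm (z - a) < \<delta>"
    using cost_approximation[OF G total] by blast
  have "\<forall>z \<delta>. \<exists>a r. \<delta> > 0 \<longrightarrow> G a r \<and> r \<le> K * norm z \<and> norm (z - a) < \<delta>"
    using approx by blast
  then obtain a r where "\<forall>z \<delta>. \<delta> > 0 \<longrightarrow>
      G (a z \<delta>) (r z \<delta>) \<and> r z \<delta> \<le> K * norm z \<and> norm (z - a z \<delta>) < \<delta>"
    unfolding choice_iff by blast
  then have a: "\<And>z \<delta>. \<delta> > 0 \<Longrightarrow> G (a z \<delta>) (r z \<delta>)"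
    and r: "\<And>z \<delta>. \<delta> > 0 \<Longrightarrow> r z \<delta> \<le> K * norm z"
    and close: "\<And>z \<delta>. \<delta> > 0 \<Longrightarrow> norm (z - a z \<delta>) < \<delta>"
    by auto
  have "\<exists>s. G z s \<and> s \<le> (2 * K) * norm z" for z
  proof (cases "z = 0")
    case True
    have "G 0 0" using total complete_cost_zero[OF G] by blast
    then show ?thesis using True by force
  next
    case False
    define \<delta> where "\<delta> k = norm z / 2 ^ Suc k" for k
    have \<delta>: "\<delta> k > 0" for k using False by (simp add: \<delta>_def)
    \<comment> \<open>The remainder after \<open>k\<close> approximations, each twice as precise as the one before.\<close>
    define res where "res = rec_nat z (\<lambda>k w. w - a w (\<delta> k))"
    have res0: "res 0 = z" and resS: "res (Suc k) = res k - a (res k) (\<delta> k)" for k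
      by (simp_all add: res_def)
    have res_le: "norm (res k) \<le> norm z * (1/2) ^ k" for k
    proof (cases k)
      case (Suc j)
      then show ?thesis
        using close[OF \<delta>[of j], of "res j"] by (simp add: resS \<delta>_def power_divide)
    qed (simp add: res0)
    define b where "b k = a (res k) (\<delta> k)" for k
    define s where "s k = r (res k) (\<delta> k)" for k
    have bs: "G (b k) (s k)" for k
      using a[OF \<delta>] by (simp add: b_def s_def)
    have s_le: "s k \<le> K * norm z * (1/2) ^ k" for k
    proof -
      have "s k \<le> K * norm (res k)" using r[OF \<delta>] by (simp add: s_def)
      also have "\<dots> \<le> K * (norm z * (1/2) ^ k)" using res_le K by simp
      finally show ?thesis by simp
    qed
    have geo: "(\<lambda>k. K * norm z * (1/2) ^ k) sums (K * norm z * 2)"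
      using sums_mult[OF geometric_sums[of "1/2::real"], of "K * norm z"] by simp
    have s_sum: "summable s"
      using s_le complete_cost_nonneg[OF G bs]
      by (intro summable_comparison_test'[OF sums_summable[OF geo], of 0]) auto
    have "(\<Sum>k<m. b k) = z - res m" for m
      by (induction m) (simp_all add: res0 resS b_def)
    moreover have "res \<longlonglongrightarrow> 0"
    proof (rule Lim_null_comparison)
      show "\<forall>\<^sub>F k in sequentially. norm (res k) \<le> norm z * (1/2) ^ k"
        using res_le by simp
      show "(\<lambda>k. norm z * (1/2) ^ k) \<longlonglongrightarrow> 0"
        by (intro tendsto_mult_right_zero LIMSEQ_power_zero) simp
    qed
    ultimately have "b sums z"
      unfolding sums_def using tendsto_diff[OF tendsto_const, of res 0 sequentially z] by simp
    then have "G z (suminf s)"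
      using complete_cost_suminf[OF G bs s_sum] by (simp add: sums_iff)
    moreover have "suminf s \<le> 2 * K * norm z"
      using suminf_le[OF s_le s_sum sums_summable[OF geo]] geo by (simp add: sums_iff mult_ac)
    ultimately show ?thesis by blast
  qed
  then show thesis using that by blast
qed

text \<open>The decomposition along \<open>M\<close> and \<open>N\<close> yields a cost on the whole space, hence a bound for the
  \<open>N\<close>-component in terms of the norm. So \<open>M\<close>, the set where that component vanishes, is closed.\<close>

lemma closed_if_complementary_operator_ranges:
  fixes M N :: "'a::banach set"
  assumes M: "operator_range M" "subspace M" and N: "operator_range N" "subspace N"
    and Int: "M \<inter> N = {0}" and sum: "M + N = UNIV"
  shows "closed M"
proof -
  obtain G H where G: "complete_cost G" and H: "complete_cost H"
    and MG: "M = {x. \<exists>r. G x r}" and NH: "N = {x. \<exists>r. H x r}"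
    using M(1) N(1) unfolding operator_range_def by blast
  let ?S = "\<lambda>z t. \<exists>x y r s. G x r \<and> H y s \<and> z = x + y \<and> t = r + s"
  have "\<exists>t. ?S z t" for z
    using UNIV_I[of z] unfolding sum[symmetric] MG NH set_plus_def by blast
  then obtain C where C: "\<And>z. \<exists>t. ?S z t \<and> t \<le> C * norm z"
    using complete_cost_bounded[OF complete_cost_plus[OF G H]] by blast
  have split: "\<exists>x\<in>M. \<exists>y\<in>N. z = x + y \<and> norm y \<le> C * norm z" for z
  proof -
    obtain x y r s where "G x r" "H y s" "z = x + y" "r + s \<le> C * norm z"
      using C[of z] by blast
    moreover have "0 \<le> r" "norm y \<le> s"
      using calculation complete_cost_nonneg[OF G] complete_cost_norm[OF H] by auto
    ultimately have "x \<in> M" "y \<in> N" "z = x + y" "norm y \<le> C * norm z"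
      unfolding MG NH by auto
    then show ?thesis by blast
  qed
  show ?thesis
    unfolding closed_sequential_limits
  proof (intro allI impI, elim conjE)
    fix f z assume f: "\<forall>n. f n \<in> M" and lim: "f \<longlonglongrightarrow> z"
    obtain x y where xy: "x \<in> M" "y \<in> N" "z = x + y"
      using split by blast
    have le: "norm y \<le> C * norm (z - f n)" for n
    proof -
      obtain u v where uv: "u \<in> M" "v \<in> N" "z - f n = u + v" "norm v \<le> C * norm (z - f n)"
        using split by blast
      have "u - (x - f n) = y - v"
        using xy(3) uv(3) by (simp add: algebra_simps)
      moreover have "u - (x - f n) \<in> M" "y - v \<in> N"
        using M(2) N(2) xy uv f by (auto intro!: subspace_diff)
      ultimately have "y - v \<in> M \<inter> N" by (metis IntI)
      then have "y = v" unfolding Int by simp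
      then show ?thesis using uv by simp
    qed
    have "(\<lambda>n. C * norm (z - f n)) \<longlonglongrightarrow> C * norm (z - z)"
      using lim by (intro tendsto_intros)
    then have "norm y \<le> C * norm (z - z)"
      using le by (intro LIMSEQ_le_const) auto
    then show "z \<in> M" using xy by simp
  qed
qed

section \<open>Bounded functionals that do not vanish at a given vector\<close>

definition sublinear :: "('a::real_vector \<Rightarrow> real) \<Rightarrow> bool"
  where "sublinear p \<longleftrightarrow> (\<forall>x y. p (x + y) \<le> p x + p y) \<and> (\<forall>c>0. \<forall>x. p (c *\<^sub>R x) \<le> c * p x)"

lemma sublinear_add: "sublinear p \<Longrightarrow> p (x + y) \<le> p x + p y"
  and sublinear_scale_le: "sublinear p \<Longrightarrow> c > 0 \<Longrightarrow> p (c *\<^sub>R x) \<le> c * p x"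
  by (auto simp: sublinear_def)

lemma sublinear_scale:
  assumes p: "sublinear p" and c: "c > 0"
  shows "p (c *\<^sub>R x) = c * p x"
proof -
  have "p x \<le> inverse c * p (c *\<^sub>R x)"
    using sublinear_scale_le[OF p, of "inverse c" "c *\<^sub>R x"] c by simp
  then have "c * p x \<le> p (c *\<^sub>R x)"
    using c by (simp add: field_simps)
  then show ?thesis
    using sublinear_scale_le[OF p c, of x] by simp
qed

lemma sublinear_zero: "sublinear p \<Longrightarrow> p 0 = 0"
  using sublinear_scale[of p 2 0] by simp

lemma sublinear_lower: "sublinear p \<Longrightarrow> - p (- x) \<le> p x"
  using sublinear_add[of p x "- x"] sublinear_zero[of p] by simp

text \<open>The largest sublinear functional below \<open>p\<close> that agrees with \<open>p\<close> at \<open>y\<close> and satisfies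
  \<open>f (x + y) = f x + f y\<close> for all \<open>x\<close>. Thus \<open>descend p y\<close> equals \<open>p\<close> whenever \<open>p\<close> is minimal,
  which forces a minimal sublinear functional to be linear. Started at the norm, it produces a value at \<open>- y\<close> as negative as possible.\<close>

definition descend :: "('a::real_vector \<Rightarrow> real) \<Rightarrow> 'a \<Rightarrow> 'a \<Rightarrow> real"
  where "descend p y x = (INF t\<in>{0..}. p (x + t *\<^sub>R y) - t * p y)"

lemma descend_le:
  assumes p: "sublinear p" and t: "t \<ge> 0"
  shows "descend p y x \<le> p (x + t *\<^sub>R y) - t * p y"
proof -
  have "bdd_below ((\<lambda>t. p (x + t *\<^sub>R y) - t * p y) ` {0..})"
  proof (rule bdd_belowI2)
    fix t :: real assume "t \<in> {0..}"
    then have "p (t *\<^sub>R y) = t * p y"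
      using sublinear_scale[OF p, of t y] sublinear_zero[OF p] by (cases "t = 0") auto
    then show "- p (- x) \<le> p (x + t *\<^sub>R y) - t * p y"
      using sublinear_add[OF p, of "x + t *\<^sub>R y" "- x"] by simp
  qed
  then show ?thesis
    unfolding descend_def using t by (intro cINF_lower) auto
qed

lemma descend_greatest:
  "(\<And>t. t \<ge> 0 \<Longrightarrow> m \<le> p (x + t *\<^sub>R y) - t * p y) \<Longrightarrow> m \<le> descend p y x"
  unfolding descend_def by (intro cINF_greatest) auto

lemma descend_le_self: "sublinear p \<Longrightarrow> descend p y x \<le> p x"
  using descend_le[of p 0 y x] by simp

lemma sublinear_descend:
  assumes p: "sublinear p"
  shows "sublinear (descend p y)"
  unfolding sublinear_def
proof (intro conjI allI impI)
  fix x z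
  have "descend p y (x + z) - (p (z + u *\<^sub>R y) - u * p y) \<le> descend p y x" if u: "u \<ge> 0" for u
  proof (rule descend_greatest)
    fix t :: real assume t: "t \<ge> 0"
    have "descend p y (x + z) \<le> p ((x + t *\<^sub>R y) + (z + u *\<^sub>R y)) - (t + u) * p y"
      using descend_le[OF p, of "t + u" y "x + z"] t u by (simp add: algebra_simps)
    then show "descend p y (x + z) - (p (z + u *\<^sub>R y) - u * p y) \<le> p (x + t *\<^sub>R y) - t * p y"
      using sublinear_add[OF p, of "x + t *\<^sub>R y" "z + u *\<^sub>R y"] by (simp add: algebra_simps)
  qed
  then have "descend p y (x + z) - descend p y x \<le> descend p y z"
    by (intro descend_greatest) (simp add: algebra_simps)
  then show "descend p y (x + z) \<le> descend p y x + descend p y z" by simp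
next
  fix c :: real and x assume c: "c > 0"
  have "descend p y (c *\<^sub>R x) / c \<le> descend p y x"
  proof (rule descend_greatest)
    fix t :: real assume t: "t \<ge> 0"
    have "descend p y (c *\<^sub>R x) \<le> p (c *\<^sub>R (x + t *\<^sub>R y)) - (c * t) * p y"
      using descend_le[OF p, of "c * t" y "c *\<^sub>R x"] c t by (simp add: scaleR_add_right)
    also have "\<dots> = c * (p (x + t *\<^sub>R y) - t * p y)"
      using sublinear_scale[OF p c] by (simp add: right_diff_distrib mult.assoc)
    finally show "descend p y (c *\<^sub>R x) / c \<le> p (x + t *\<^sub>R y) - t * p y"
      using c by (simp add: pos_divide_le_eq mult.commute)
  qed
  then show "descend p y (c *\<^sub>R x) \<le> c * descend p y x"
    using c by (simp add: pos_divide_le_eq mult.commute)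
qed

text \<open>Zorn's lemma for the pointwise order: a chain below \<open>q\<close> has a pointwise infimum because every
  sublinear \<open>p \<le> q\<close> satisfies \<open>p x \<ge> - q (- x)\<close>.\<close>

lemma minimal_sublinear:
  fixes q :: "'a::real_vector \<Rightarrow> real"
  assumes q: "sublinear q"
  obtains p where "sublinear p" "\<And>x. p x \<le> q x"
    "\<And>p'. sublinear p' \<Longrightarrow> (\<And>x. p' x \<le> p x) \<Longrightarrow> p' = p"
proof -
  define A where "A = {p. sublinear p \<and> p \<le> q}"
  have po: "partial_order_on A (relation_of (\<ge>) A)"
    by (auto simp: partial_order_on_def preorder_on_def refl_on_def trans_def antisym_def
        relation_of_def)
  have "\<exists>u\<in>A. \<forall>p\<in>C. u \<le> p" if C: "C \<in> Chains (relation_of (\<ge>) A)" for C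
  proof (cases "C = {}")
    case True
    then show ?thesis using q by (auto simp: A_def)
  next
    case False
    have CA: "p \<in> A" if "p \<in> C" for p
      using C that by (auto simp: Chains_def relation_of_def)
    have chain: "p \<le> p' \<or> p' \<le> p" if "p \<in> C" "p' \<in> C" for p p'
      using C that by (auto simp: Chains_def relation_of_def)
    define u where "u x = (INF p\<in>C. p x)" for x
    have bdd: "bdd_below ((\<lambda>p. p x) ` C)" for x
    proof (rule bdd_belowI2)
      fix p assume "p \<in> C"
      then have "sublinear p" "p (- x) \<le> q (- x)"
        using CA by (auto simp: A_def le_fun_def)
      then show "- q (- x) \<le> p x"
        using sublinear_lower[of p x] by simp
    qed
    have u_le: "u x \<le> p x" if "p \<in> C" for p x
      unfolding u_def using bdd that by (rule cINF_lower)
    have u_greatest: "m \<le> u x" if "\<And>p. p \<in> C \<Longrightarrow> m \<le> p x" for m x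
      unfolding u_def using False that by (rule cINF_greatest)
    have "sublinear u"
      unfolding sublinear_def
    proof (intro conjI allI impI)
      fix x y
      have "u (x + y) - p' y \<le> p x" if pp': "p \<in> C" "p' \<in> C" for p p'
      proof -
        obtain r where r: "r \<in> C" "r \<le> p" "r \<le> p'"
          using chain[OF pp'] pp' by blast
        then have "u (x + y) \<le> r x + r y"
          using u_le[of r "x + y"] CA sublinear_add[of r x y] by (fastforce simp: A_def)
        moreover have "r x \<le> p x" "r y \<le> p' y"
          using r by (auto simp: le_fun_def)
        ultimately show ?thesis by simp
      qed
      then have "u (x + y) - p' y \<le> u x" if "p' \<in> C" for p'
        using that by (intro u_greatest)
      then have "u (x + y) - u x \<le> u y"
        by (intro u_greatest) (simp add: algebra_simps)
      then show "u (x + y) \<le> u x + u y" by simp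
    next
      fix c :: real and x assume c: "c > 0"
      have "u (c *\<^sub>R x) / c \<le> u x"
      proof (rule u_greatest)
        fix p assume "p \<in> C"
        then have "u (c *\<^sub>R x) \<le> c * p x"
          using u_le[of p "c *\<^sub>R x"] CA sublinear_scale[OF _ c, of p x] by (auto simp: A_def)
        then show "u (c *\<^sub>R x) / c \<le> p x"
          using c by (simp add: pos_divide_le_eq mult.commute)
      qed
      then show "u (c *\<^sub>R x) \<le> c * u x"
        using c by (simp add: pos_divide_le_eq mult.commute)
    qed
    moreover have "u \<le> q"
    proof -
      obtain p where p: "p \<in> C" using False by blast
      then have "u \<le> p" using u_le by (auto simp: le_fun_def)
      also have "p \<le> q" using CA[OF p] by (simp add: A_def)
      finally show ?thesis .
    qed
    moreover have "\<forall>p\<in>C. u \<le> p" using u_le by (auto simp: le_fun_def)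
    ultimately show ?thesis by (auto simp: A_def)
  qed
  then obtain p where p: "p \<in> A" and min: "\<And>p'. p' \<in> A \<Longrightarrow> p' \<le> p \<Longrightarrow> p' = p"
    using predicate_Zorn[OF po] by blast
  show thesis
  proof (rule that)
    show "sublinear p" "p x \<le> q x" for x
      using p by (auto simp: A_def le_fun_def)
    show "p' = p" if "sublinear p'" "\<And>x. p' x \<le> p x" for p'
      using p that by (intro min) (auto simp: A_def le_fun_def intro: order_trans)
  qed
qed

text \<open>The Hahn-Banach theorem in the form needed here: a minimal sublinear functional is linear.\<close>

lemma linear_functional_below_sublinear:
  fixes q :: "'a::real_vector \<Rightarrow> real"
  assumes "sublinear q"
  obtains f where "linear f" "\<And>x. f x \<le> q x"
proof -
  obtain p where p: "sublinear p" and pq: "\<And>x. p x \<le> q x"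
    and min: "\<And>p'. sublinear p' \<Longrightarrow> (\<And>x. p' x \<le> p x) \<Longrightarrow> p' = p"
    using minimal_sublinear[OF assms] by blast
  have "descend p y = p" for y
    using sublinear_descend[OF p] descend_le_self[OF p] by (rule min)
  then have "p x \<le> p (x + y) - p y" for x y
    using descend_le[OF p, of 1 y x] by simp
  then have add: "p (x + y) = p x + p y" for x y
    using sublinear_add[OF p, of x y] by (smt (verit))
  have neg: "p (- x) = - p x" for x
    using add[of x "- x"] sublinear_zero[OF p] by simp
  have "p (c *\<^sub>R x) = c * p x" for c x
  proof (cases c "0::real" rule: linorder_cases)
    case less
    then show ?thesis
      using sublinear_scale[OF p, of "- c" x] neg[of "c *\<^sub>R x"] by simp
  qed (use sublinear_scale[OF p] sublinear_zero[OF p] in auto)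
  then have "linear p"
    using add by (intro linearI) auto
  then show thesis using that pq by blast
qed

lemma bounded_functional_nonzero_at:
  fixes v :: "'a::real_normed_vector"
  assumes "v \<noteq> 0"
  obtains f :: "'a \<Rightarrow> real" where "bounded_linear f" "f v \<noteq> 0"
proof -
  have norm: "sublinear (norm :: 'a \<Rightarrow> real)"
    by (simp add: sublinear_def norm_triangle_ineq)
  obtain f where f: "linear f" and le: "\<And>x. f x \<le> descend norm v x"
    using linear_functional_below_sublinear[OF sublinear_descend[OF norm]] by blast
  have le_norm: "f x \<le> norm x" for x
    using le[of x] descend_le_self[OF norm, of v x] by simp
  have "\<bar>f x\<bar> \<le> norm x" for x
    using le_norm[of x] le_norm[of "- x"] linear_neg[OF f, of x] by simp
  then have "bounded_linear f"
    using linear_add[OF f] linear_scale[OF f] by (intro bounded_linear_intro[of f 1]) auto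
  moreover have "f (- v) \<le> - norm v"
    using le[of "- v"] descend_le[OF norm, of 1 v "- v"] by simp
  then have "f v \<noteq> 0"
    using linear_neg[OF f, of v] assms by auto
  ultimately show thesis using that by blast
qed

text \<open>A real functional \<open>f\<close> is the real part of the complex functional \<open>x \<mapsto> f x - \<i> f (\<i> x)\<close>.\<close>

lemma bounded_clinear_functional_nonzero_at:
  fixes v :: "'a::complex_banach"
  assumes "v \<noteq> 0"
  obtains g :: "'a \<Rightarrow> complex" where "bounded_linear g" "\<And>c x. g (c *\<^sub>C x) = c * g x" "g v \<noteq> 0"
proof -
  obtain f :: "'a \<Rightarrow> real" where f: "bounded_linear f" and fv: "f v \<noteq> 0"
    using bounded_functional_nonzero_at[OF assms] by blast
  interpret f: bounded_linear f by fact
  have i: "bounded_linear (\<lambda>x::'a. \<i> *\<^sub>C x)"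
  proof (rule bounded_linear_intro[of _ 1])
    show "\<i> *\<^sub>C (r *\<^sub>R x) = r *\<^sub>R (\<i> *\<^sub>C x)" for r and x :: 'a
      by (simp add: scaleC_scaleC mult.commute flip: scaleC_of_real)
  qed (auto simp: scaleC_add_right norm_scaleC)
  define g where "g x = Complex (f x) (- f (\<i> *\<^sub>C x))" for x
  have g_alt: "g x = of_real (f x) - \<i> * of_real (f (\<i> *\<^sub>C x))" for x
    by (simp add: g_def complex_eq_iff)
  have "bounded_linear g"
    unfolding g_alt
    by (intro bounded_linear_sub bounded_linear_const_mult bounded_linear_compose[OF bounded_linear_of_real]
        bounded_linear_compose[OF f] i f)
  moreover have "g (c *\<^sub>C x) = c * g x" for c x
  proof -
    have "c *\<^sub>C x = Re c *\<^sub>R x + Im c *\<^sub>R (\<i> *\<^sub>C x)"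
      unfolding scaleC_of_real[symmetric] scaleC_scaleC scaleC_add_left[symmetric]
      by (rule arg_cong[of _ _ "\<lambda>c. c *\<^sub>C x"]) (simp add: complex_eq_iff)
    moreover have "\<i> *\<^sub>C c *\<^sub>C x = Re c *\<^sub>R (\<i> *\<^sub>C x) + (- Im c) *\<^sub>R x"
      unfolding scaleC_of_real[symmetric] scaleC_scaleC scaleC_add_left[symmetric]
      by (rule arg_cong[of _ _ "\<lambda>c. c *\<^sub>C x"]) (simp add: complex_eq_iff)
    ultimately show ?thesis
      by (simp add: g_def f.add f.scaleR f.neg complex_eq_iff del: scaleR_minus_left)
  qed
  moreover have "g v \<noteq> 0"
    using fv by (simp add: g_def complex_eq_iff)
  ultimately show thesis using that by blast
qed

section \<open>Complements among operator ranges\<close>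

lemma csubspace_imp_subspace: "csubspace M \<Longrightarrow> subspace M"
  by (auto simp: subspace_def complex_vector.subspace_0 complex_vector.subspace_add
      simp flip: scaleC_of_real intro: complex_vector.subspace_scale)

lemma csubspace_plus: "csubspace M \<Longrightarrow> csubspace N \<Longrightarrow> csubspace (M + N)"
proof -
  have "M + N = {x + y |x y. x \<in> M \<and> y \<in> N}"
    by (auto simp: set_plus_def)
  then show "csubspace M \<Longrightarrow> csubspace N \<Longrightarrow> csubspace (M + N)"
    using complex_vector.subspace_sums[of M N] by simp
qed

lemma csubspace_plusE:
  assumes "x \<in> M + N"
  obtains y z where "y \<in> M" "z \<in> N" "x = y + z"
  using assms by (rule set_plus_elim)

lemma subset_plus_left: "csubspace N \<Longrightarrow> M \<subseteq> M + N"
  using complex_vector.subspace_0 by (metis add.commute set_zero_plus2)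

lemma subset_plus_right: "csubspace M \<Longrightarrow> N \<subseteq> M + N"
  using complex_vector.subspace_0 by (metis set_zero_plus2)

lemma plus_subset_csubspace: "csubspace L \<Longrightarrow> M \<subseteq> L \<Longrightarrow> N \<subseteq> L \<Longrightarrow> M + N \<subseteq> L"
  by (auto elim!: csubspace_plusE intro: complex_vector.subspace_add)

lemma mem_cspan_singleton: "x \<in> cspan {v} \<longleftrightarrow> (\<exists>c. x = c *\<^sub>C v)"
  by (auto simp: complex_vector.span_singleton)

lemma plus_cspan_singletonE:
  assumes "x \<in> M + cspan {v}"
  obtains y c where "y \<in> M" "x = y + c *\<^sub>C v"
  using assms by (metis csubspace_plusE mem_cspan_singleton)

lemma operator_range_csubspace: "closed M \<Longrightarrow> csubspace M \<Longrightarrow> operator_range M"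
  by (simp add: operator_range_closed_subspace csubspace_imp_subspace)

lemma operator_range_UNIV: "operator_range (UNIV :: 'a::complex_banach set)"
  by (simp add: operator_range_csubspace complex_vector.subspace_UNIV)

lemma operator_range_zero: "operator_range {0 :: 'a::complex_banach}"
  by (simp add: operator_range_csubspace complex_vector.subspace_single_0)

lemma operator_range_cspan_singleton: "operator_range (cspan {v})"
proof (rule operator_range_csubspace)
  show "closed (cspan {v})"
  proof (cases "v = 0")
    case False
    have "bounded_linear (\<lambda>c. c *\<^sub>C v)"
    proof (rule bounded_linear_intro[of _ "norm v"])
      show "(r *\<^sub>R c) *\<^sub>C v = r *\<^sub>R (c *\<^sub>C v)" for r c
        by (simp add: scaleC_scaleC scaleR_conv_of_real flip: scaleC_of_real)
    qed (simp_all add: scaleC_add_left norm_scaleC)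
    then have "complete (range (\<lambda>c. c *\<^sub>C v))"
      using False by (intro complete_isometric_image[of "norm v"])
        (auto simp: norm_scaleC complete_UNIV)
    then show ?thesis
      by (simp add: complex_vector.span_singleton complete_imp_closed)
  qed (simp add: complex_vector.span_singleton)
qed simp

text \<open>Algebraic complements inside the class of operator ranges. By the lemma
  \<open>topologically_complemented_iff\<close> this is topological complementation. It is the easier notion to
  verify: sums, intersections, images and preimages of operator ranges are operator ranges, while
  images and sums of closed subspaces need not be closed.\<close>

definition complementary :: "'a::complex_banach set \<Rightarrow> 'a set \<Rightarrow> bool"
  where "complementary M N \<longleftrightarrow> csubspace M \<and> csubspace N \<and> operator_range M \<and> operator_range N \<and>
    M \<inter> N = {0} \<and> M + N = UNIV"

lemma complementaryI:
  assumes "csubspace M" "csubspace N" "operator_range M" "operator_range N"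
    and Int: "\<And>x. x \<in> M \<Longrightarrow> x \<in> N \<Longrightarrow> x = 0" and sum: "\<And>x. x \<in> M + N"
  shows "complementary M N"
proof -
  have "M \<inter> N = {0}"
    using Int assms(1,2)[THEN complex_vector.subspace_0] by blast
  then show ?thesis
    using assms unfolding complementary_def by blast
qed

lemma complementary_sumE:
  assumes "complementary M N"
  obtains y z where "y \<in> M" "z \<in> N" "x = y + z"
  using assms UNIV_I[of x] unfolding complementary_def by (metis csubspace_plusE)

lemma complementary_zeroD: "complementary M N \<Longrightarrow> x \<in> M \<Longrightarrow> x \<in> N \<Longrightarrow> x = 0"
  unfolding complementary_def by blast

lemma topologically_complemented_iff:
  "topologically_complemented M \<longleftrightarrow> (\<exists>N. complementary M N)"
proof
  assume "topologically_complemented M"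
  then show "\<exists>N. complementary M N"
    unfolding topologically_complemented_def complementary_def
    by (metis operator_range_csubspace)
next
  assume "\<exists>N. complementary M N"
  then obtain N where N: "complementary M N" by blast
  then have "closed M" "closed N"
    using closed_if_complementary_operator_ranges[of M N] closed_if_complementary_operator_ranges[of N M]
    by (simp_all add: complementary_def csubspace_imp_subspace Int_commute add.commute)
  then show "topologically_complemented M"
    using N unfolding topologically_complemented_def complementary_def by metis
qed

section \<open>Finite-dimensional extensions\<close>

definition finite_modulo :: "'a::complex_banach set \<Rightarrow> 'a set \<Rightarrow> bool"
  where "finite_modulo L M \<longleftrightarrow> (\<exists>B. finite B \<and> L \<subseteq> M + cspan B)"

lemma finite_modulo_subset: "L \<subseteq> M \<Longrightarrow> finite_modulo L M"
  unfolding finite_modulo_def by (intro exI[of _ "{}"]) simp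

lemma finite_modulo_mono: "finite_modulo L M \<Longrightarrow> L' \<subseteq> L \<Longrightarrow> M \<subseteq> M' \<Longrightarrow> finite_modulo L' M'"
proof -
  assume "finite_modulo L M" and sub: "L' \<subseteq> L" "M \<subseteq> M'"
  then obtain B where B: "finite B" "L \<subseteq> M + cspan B"
    unfolding finite_modulo_def by blast
  have "L' \<subseteq> M' + cspan B"
    using sub(1) B(2) set_plus_mono2[OF sub(2) order_refl[of "cspan B"]] by (rule order_trans[OF order_trans])
  then show "finite_modulo L' M'"
    unfolding finite_modulo_def using B(1) by blast
qed

lemma finite_modulo_trans:
  assumes "finite_modulo K L" "finite_modulo L M"
  shows "finite_modulo K M"
proof -
  obtain B B' where fin: "finite B" "finite B'" and sub: "K \<subseteq> L + cspan B" "L \<subseteq> M + cspan B'"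
    using assms unfolding finite_modulo_def by blast
  have "cspan B' + cspan B \<subseteq> cspan (B' \<union> B)"
    by (intro plus_subset_csubspace complex_vector.span_mono) auto
  then have "M + cspan B' + cspan B \<subseteq> M + cspan (B' \<union> B)"
    unfolding add.assoc by (rule set_plus_mono2[OF order_refl])
  then have "K \<subseteq> M + cspan (B' \<union> B)"
    using order_trans[OF sub(1) set_plus_mono2[OF sub(2) order_refl[of "cspan B"]]]
    by (rule order_trans[rotated])
  then show ?thesis
    unfolding finite_modulo_def using fin by blast
qed

lemma finite_modulo_plus: "finite_modulo L M \<Longrightarrow> finite_modulo (L + K) (M + K)"
proof -
  assume "finite_modulo L M"
  then obtain B where B: "finite B" "L \<subseteq> M + cspan B"
    unfolding finite_modulo_def by blast
  have "L + K \<subseteq> (M + cspan B) + K"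
    using B(2) by (rule set_plus_mono2) simp
  also have "\<dots> = (M + K) + cspan B"
    by (simp add: ac_simps)
  finally show "finite_modulo (L + K) (M + K)"
    unfolding finite_modulo_def using B(1) by blast
qed

text \<open>A subspace that is finite-dimensional modulo \<open>M\<close> is reached from \<open>M\<close> by adjoining finitely many
  vectors one at a time. The induction is on a finite set \<open>B\<close> spanning modulo \<open>M\<close>: removing \<open>b\<close> from
  it cuts \<open>M'\<close> down to \<open>M' \<inter> (M + cspan B)\<close>, which differs from \<open>M'\<close> by at most one dimension.\<close>

lemma finite_extension_induct:
  assumes fin: "finite_modulo M' M" and M: "csubspace M" and M': "csubspace M'" "M \<subseteq> M'"
    and base: "P M"
    and step: "\<And>N v. csubspace N \<Longrightarrow> P N \<Longrightarrow> v \<notin> N \<Longrightarrow> P (N + cspan {v})"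
  shows "P M'"
proof -
  obtain B where "finite B" "M' \<subseteq> M + cspan B"
    using fin unfolding finite_modulo_def by blast
  then show ?thesis
    using M'
  proof (induction B arbitrary: M' rule: finite_induct)
    case empty
    then have "M' = M" by simp
    then show ?case using base by simp
  next
    case (insert b B)
    define L where "L = M + cspan B"
    have L: "csubspace L"
      unfolding L_def by (intro csubspace_plus M) simp
    have "M \<subseteq> L" unfolding L_def by (rule subset_plus_left) simp
    define N where "N = M' \<inter> L"
    have N: "csubspace N"
      unfolding N_def using insert.prems(2) L by (rule complex_vector.subspace_inter)
    have PN: "P N"
    proof (rule insert.IH)
      show "N \<subseteq> M + cspan B" by (simp add: N_def L_def)
      show "csubspace N" by fact
      show "M \<subseteq> N" using \<open>M \<subseteq> L\<close> insert.prems(3) by (simp add: N_def)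
    qed
    have mod_b: "\<exists>k. x - k *\<^sub>C b \<in> L" if "x \<in> M'" for x
    proof -
      have "x \<in> M + cspan (insert b B)"
        using insert.prems(1) that by (rule subsetD)
      then obtain m s where ms: "m \<in> M" "s \<in> cspan (insert b B)" "x = m + s"
        by (rule csubspace_plusE)
      obtain k where "s - k *\<^sub>C b \<in> cspan B"
        using complex_vector.span_breakdown[OF insertI1 ms(2)] insert.hyps(2) by auto
      then have "m + (s - k *\<^sub>C b) \<in> L"
        unfolding L_def using ms(1) by (rule set_plus_intro[rotated])
      then show ?thesis
        using ms(3) by (intro exI[of _ k]) (simp add: algebra_simps)
    qed
    show ?case
    proof (cases "M' = N")
      case True
      then show ?thesis using PN by simp
    next
      case False
      then obtain v where v: "v \<in> M'" "v \<notin> N"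
        using N_def by blast
      obtain k where k: "v - k *\<^sub>C b \<in> L"
        using mod_b[OF v(1)] by blast
      have "k \<noteq> 0" using k v by (auto simp: N_def)
      have "M' \<subseteq> N + cspan {v}"
      proof
        fix x assume x: "x \<in> M'"
        obtain l where l: "x - l *\<^sub>C b \<in> L"
          using mod_b[OF x] by blast
        let ?c = "l / k"
        have "(x - l *\<^sub>C b) - ?c *\<^sub>C (v - k *\<^sub>C b) \<in> L"
          using l complex_vector.subspace_scale[OF L k] by (rule complex_vector.subspace_diff[OF L])
        also have "(x - l *\<^sub>C b) - ?c *\<^sub>C (v - k *\<^sub>C b) = x - ?c *\<^sub>C v"
          using \<open>k \<noteq> 0\<close> by (simp add: complex_vector.scale_right_diff_distrib scaleC_scaleC)
        finally have "x - ?c *\<^sub>C v \<in> N"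
          unfolding N_def using insert.prems(2) x v(1)
          by (auto intro: complex_vector.subspace_diff complex_vector.subspace_scale)
        then have "(x - ?c *\<^sub>C v) + ?c *\<^sub>C v \<in> N + cspan {v}"
          by (intro set_plus_intro) (auto simp: mem_cspan_singleton)
        then show "x \<in> N + cspan {v}" by simp
      qed
      moreover have "N + cspan {v} \<subseteq> M'"
        using v(1) insert.prems(2)
        by (intro plus_subset_csubspace complex_vector.span_minimal) (auto simp: N_def)
      ultimately have "M' = N + cspan {v}" by simp
      then show ?thesis using step[OF N PN v(2)] by simp
    qed
  qed
qed

text \<open>Adjoining one vector to a subspace enlarges its intersection with \<open>K\<close> by at most one dimension.\<close>

lemma finite_modulo_Int:
  assumes fin: "finite_modulo L M" and M: "csubspace M" and L: "csubspace L" "M \<subseteq> L"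
    and K: "csubspace K"
  shows "finite_modulo (L \<inter> K) (M \<inter> K)"
  using fin M L
proof (rule finite_extension_induct)
  show "finite_modulo (M \<inter> K) (M \<inter> K)" by (simp add: finite_modulo_subset)
  fix N v assume N: "csubspace N" and NK: "finite_modulo (N \<inter> K) (M \<inter> K)" and v: "v \<notin> N"
  show "finite_modulo ((N + cspan {v}) \<inter> K) (M \<inter> K)"
  proof (cases "(N + cspan {v}) \<inter> K \<subseteq> N")
    case True
    then show ?thesis using finite_modulo_mono[OF NK] by blast
  next
    case False
    then obtain w where w0: "w \<in> N + cspan {v}" "w \<in> K" "w \<notin> N" by blast
    obtain n c where "n \<in> N" "w = n + c *\<^sub>C v"
      using w0(1) by (rule plus_cspan_singletonE)
    then have w: "n + c *\<^sub>C v \<in> K" "n \<in> N" "n + c *\<^sub>C v \<notin> N"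
      using w0 by simp_all
    then have c: "c \<noteq> 0" by auto
    have "(N + cspan {v}) \<inter> K \<subseteq> (N \<inter> K) + cspan {n + c *\<^sub>C v}"
    proof
      fix x assume x: "x \<in> (N + cspan {v}) \<inter> K"
      then have "x \<in> N + cspan {v}" by simp
      then obtain n' c' where n': "n' \<in> N" "x = n' + c' *\<^sub>C v"
        by (rule plus_cspan_singletonE)
      let ?w = "(c' / c) *\<^sub>C (n + c *\<^sub>C v)"
      have "x - ?w = n' - (c' / c) *\<^sub>C n"
        using c by (simp add: n'(2) scaleC_add_right scaleC_scaleC)
      then have "x - ?w \<in> N"
        using N n'(1) w(2) by (auto intro: complex_vector.subspace_diff complex_vector.subspace_scale)
      moreover have "x - ?w \<in> K"
        using K x w(1) by (auto intro: complex_vector.subspace_diff complex_vector.subspace_scale)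
      ultimately have "(x - ?w) + ?w \<in> (N \<inter> K) + cspan {n + c *\<^sub>C v}"
        by (intro set_plus_intro) (auto simp: mem_cspan_singleton)
      then show "x \<in> (N \<inter> K) + cspan {n + c *\<^sub>C v}" by simp
    qed
    then have "finite_modulo ((N + cspan {v}) \<inter> K) (N \<inter> K)"
      unfolding finite_modulo_def by blast
    then show ?thesis using NK by (rule finite_modulo_trans)
  qed
qed

text \<open>The union of the chain arises from \<open>M d\<close> by adjoining finitely many vectors, and each of them lies in
  some member of the chain.\<close>

lemma finite_modulo_chain_stabilizes:
  fixes M :: "nat \<Rightarrow> 'a::complex_banach set"
  assumes sub: "\<And>n. csubspace (M n)" and mono: "\<And>m n. m \<le> n \<Longrightarrow> M m \<subseteq> M n"
    and fin: "finite_modulo (\<Union>n. M n) (M d)"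
  obtains k where "\<And>n. n \<ge> k \<Longrightarrow> M n = M k"
proof -
  let ?U = "\<Union>n. M n"
  have U: "csubspace ?U"
    unfolding complex_vector.subspace_def
  proof (intro conjI ballI allI)
    show "0 \<in> ?U" using complex_vector.subspace_0[OF sub] by blast
    fix x assume x: "x \<in> ?U"
    then show "c *\<^sub>C x \<in> ?U" for c
      using complex_vector.subspace_scale[OF sub] by blast
    fix y assume "y \<in> ?U"
    then obtain m n where "x \<in> M m" "y \<in> M n" using x by blast
    then have "x \<in> M (max m n)" "y \<in> M (max m n)"
      using mono[of m "max m n"] mono[of n "max m n"] by auto
    then show "x + y \<in> ?U"
      using complex_vector.subspace_add[OF sub] by blast
  qed
  have "?U \<subseteq> ?U \<longrightarrow> (\<exists>k. ?U \<subseteq> M k)"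
    using fin sub U
  proof (rule finite_extension_induct[where P = "\<lambda>N. N \<subseteq> ?U \<longrightarrow> (\<exists>k. N \<subseteq> M k)"])
    show "M d \<subseteq> ?U" by blast
    show "M d \<subseteq> ?U \<longrightarrow> (\<exists>k. M d \<subseteq> M k)" by blast
    fix N v assume N: "csubspace N" and IH: "N \<subseteq> ?U \<longrightarrow> (\<exists>k. N \<subseteq> M k)"
    show "N + cspan {v} \<subseteq> ?U \<longrightarrow> (\<exists>k. N + cspan {v} \<subseteq> M k)"
    proof
      assume sub_U: "N + cspan {v} \<subseteq> ?U"
      have "N \<subseteq> N + cspan {v}"
        by (rule subset_plus_left) simp
      then obtain k where k: "N \<subseteq> M k"
        using IH sub_U by blast
      have "v \<in> N + cspan {v}"
        using subset_plus_right[OF N, of "cspan {v}"] complex_vector.span_base[of v "{v}"] by blast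
      then obtain l where "v \<in> M l" using sub_U by blast
      then have "N \<subseteq> M (max k l)" "{v} \<subseteq> M (max k l)"
        using k mono[of k "max k l"] mono[of l "max k l"] by auto
      then have "N \<subseteq> M (max k l)" "cspan {v} \<subseteq> M (max k l)"
        using complex_vector.span_minimal[OF _ sub] by blast+
      then show "\<exists>k. N + cspan {v} \<subseteq> M k"
        using plus_subset_csubspace[OF sub] by blast
    qed
  qed
  then obtain k where "?U \<subseteq> M k" by blast
  then have "M n = M k" if "n \<ge> k" for n
    using mono[OF that] by blast
  then show thesis using that by blast
qed

lemma complement_in_finite_extension:
  assumes "finite_modulo L M" and M: "csubspace M" and "csubspace L" "M \<subseteq> L"
  obtains E where "csubspace E" "operator_range E" "M \<inter> E = {0}" "M + E = L"
proof -
  have "\<exists>E. csubspace E \<and> operator_range E \<and> M \<inter> E = {0} \<and> M + E = L"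
    using assms
  proof (rule finite_extension_induct)
    show "\<exists>E. csubspace E \<and> operator_range E \<and> M \<inter> E = {0} \<and> M + E = M"
      using operator_range_zero complex_vector.subspace_0[OF M]
      by (intro exI[of _ "{0}"]) simp
    fix N v
    assume "\<exists>E. csubspace E \<and> operator_range E \<and> M \<inter> E = {0} \<and> M + E = N" and v: "v \<notin> N"
    then obtain E where E: "csubspace E" "operator_range E" "M \<inter> E = {0}" "M + E = N"
      by blast
    have "M \<inter> (E + cspan {v}) \<subseteq> {0}"
    proof
      fix x assume "x \<in> M \<inter> (E + cspan {v})"
      then obtain e c where x: "x \<in> M" "e \<in> E" "x = e + c *\<^sub>C v"
        by (auto elim!: csubspace_plusE simp: mem_cspan_singleton)
      show "x \<in> {0}"
      proof (cases "c = 0")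
        case True
        then show ?thesis using x E(3) by auto
      next
        case False
        have "x + - e \<in> M + E"
          using x(1,2) E(1) by (intro set_plus_intro complex_vector.subspace_neg)
        then have "c *\<^sub>C v \<in> N"
          using x(3) by (simp add: E(4))
        then have "inverse c *\<^sub>C (c *\<^sub>C v) \<in> N"
          using csubspace_plus[OF M E(1)] unfolding E(4) by (rule complex_vector.subspace_scale[rotated])
        then show ?thesis using v False by (simp add: scaleC_scaleC)
      qed
    qed
    moreover have "csubspace (E + cspan {v})"
      by (intro csubspace_plus E(1)) simp
    moreover have "M + (E + cspan {v}) = N + cspan {v}"
      by (simp add: E(4) flip: add.assoc)
    moreover have "operator_range (E + cspan {v})"
      by (intro operator_range_plus E(2) operator_range_cspan_singleton)
    ultimately show "\<exists>E. csubspace E \<and> operator_range E \<and> M \<inter> E = {0} \<and> M + E = N + cspan {v}"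
      using M complex_vector.subspace_0 by blast
  qed
  then show thesis using that by blast
qed

text \<open>A complement of \<open>M\<close> arises from one of \<open>L\<close> by adding a finite-dimensional complement of
  \<open>M\<close> in \<open>L\<close>.\<close>

lemma complementary_finite_restriction:
  assumes L: "complementary L N" and fin: "finite_modulo L M"
    and M: "csubspace M" "operator_range M" "M \<subseteq> L"
  shows "\<exists>N. complementary M N"
proof -
  have sub: "csubspace L" "csubspace N" "operator_range N" "L + N = UNIV"
    using L by (auto simp: complementary_def)
  obtain E where E: "csubspace E" "operator_range E" "M \<inter> E = {0}" "M + E = L"
    using complement_in_finite_extension[OF fin M(1) sub(1) M(3)] by blast
  have "complementary M (E + N)"
  proof (rule complementaryI)
    show "csubspace (E + N)" using E(1) sub(2) by (rule csubspace_plus)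
    show "operator_range (E + N)" using E(2) sub(3) by (rule operator_range_plus)
    show "x \<in> M + (E + N)" for x
      using UNIV_I[of x] unfolding add.assoc[symmetric] E(4) sub(4) .
    fix x assume x: "x \<in> M" "x \<in> E + N"
    then obtain e n where en: "e \<in> E" "n \<in> N" "x = e + n"
      by (auto elim: csubspace_plusE)
    have "E \<subseteq> L" using subset_plus_right[OF M(1), of E] E(4) by simp
    then have "x - e \<in> L"
      using x(1) en(1) M(3) by (intro complex_vector.subspace_diff[OF sub(1)]) auto
    then have "n = 0"
      using complementary_zeroD[OF L, of n] en by simp
    then show "x = 0" using x(1) en E(3) by auto
  qed (use M in auto)
  then show ?thesis by blast
qed

text \<open>The only place where Hahn-Banach enters: to adjoin one vector to \<open>M\<close>, its component \<open>n\<close> in the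
  complement \<open>N\<close> is split off by the kernel of a functional that does not vanish at \<open>n\<close>. Without such
  functionals not even a line is complemented.\<close>

lemma complementary_finite_extension:
  fixes M :: "'a::complex_banach set"
  assumes compl: "complementary M N" and fin: "finite_modulo L M"
    and L: "csubspace L" "M \<subseteq> L"
  shows "\<exists>N. complementary L N"
  using fin _ L
proof (rule finite_extension_induct)
  show "csubspace M" using compl by (simp add: complementary_def)
  show "\<exists>N. complementary M N" using compl by blast
  fix M :: "'a set" and v assume "\<exists>N. complementary M N" and v: "v \<notin> M"
  then obtain N where N: "complementary M N" by blast
  then have sub: "csubspace M" "csubspace N" "operator_range M" "operator_range N"
    by (simp_all add: complementary_def)
  obtain m n where mn: "m \<in> M" "n \<in> N" "v = m + n"
    using complementary_sumE[OF N] by blast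
  then have "n \<noteq> 0" using v by auto
  then obtain g :: "'a \<Rightarrow> complex" where g: "bounded_linear g" "\<And>c x. g (c *\<^sub>C x) = c * g x" "g n \<noteq> 0"
    using bounded_clinear_functional_nonzero_at by blast
  interpret g: bounded_linear g by fact
  let ?K = "{x. g x = 0}"
  have K: "csubspace ?K"
    by (simp add: complex_vector.subspace_def g.zero g.add g(2))
  have "closed ?K"
    by (intro closed_Collect_eq continuous_on_const g.continuous_on continuous_on_id)
  then have Kr: "operator_range ?K"
    using K by (rule operator_range_csubspace)
  have "complementary (M + cspan {v}) (N \<inter> ?K)"
  proof (rule complementaryI)
    show "csubspace (M + cspan {v})" by (intro csubspace_plus sub) simp
    show "csubspace (N \<inter> ?K)" by (intro complex_vector.subspace_inter sub K)
    show "operator_range (M + cspan {v})"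
      by (intro operator_range_plus operator_range_cspan_singleton sub)
    show "operator_range (N \<inter> ?K)" by (intro operator_range_Int sub Kr)
  next
    fix x assume xM: "x \<in> M + cspan {v}" and x': "x \<in> N \<inter> ?K"
    obtain m' c where x: "m' \<in> M" "x = m' + c *\<^sub>C v"
      using xM by (rule plus_cspan_singletonE)
    have "x - c *\<^sub>C n = m' + c *\<^sub>C m"
      by (simp add: x(2) mn(3) scaleC_add_right)
    moreover have "x - c *\<^sub>C n \<in> N" "m' + c *\<^sub>C m \<in> M"
      using x x' mn sub by (auto intro: complex_vector.subspace_diff complex_vector.subspace_add
          complex_vector.subspace_scale)
    ultimately have "x - c *\<^sub>C n = 0"
      using complementary_zeroD[OF N] by metis
    then have x_eq: "x = c *\<^sub>C n" by simp
    then have "c = 0" using x' g(2,3) by simp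
    then show "x = 0" using x_eq by simp
  next
    fix x
    obtain m1 n1 where x: "m1 \<in> M" "n1 \<in> N" "x = m1 + n1"
      using complementary_sumE[OF N] by blast
    let ?c = "g n1 / g n"
    have "m1 - ?c *\<^sub>C m \<in> M"
      using sub(1) x mn by (auto intro: complex_vector.subspace_diff complex_vector.subspace_scale)
    then have "(m1 - ?c *\<^sub>C m) + ?c *\<^sub>C v \<in> M + cspan {v}"
      by (intro set_plus_intro) (auto simp: mem_cspan_singleton)
    moreover have "n1 - ?c *\<^sub>C n \<in> N \<inter> ?K"
      using sub(2) x mn g(3)
      by (auto simp: g.diff g(2) intro: complex_vector.subspace_diff complex_vector.subspace_scale)
    ultimately have "((m1 - ?c *\<^sub>C m) + ?c *\<^sub>C v) + (n1 - ?c *\<^sub>C n) \<in> (M + cspan {v}) + (N \<inter> ?K)"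
      by (rule set_plus_intro)
    then show "x \<in> (M + cspan {v}) + (N \<inter> ?K)"
      by (simp add: x(3) mn(3) scaleC_add_right)
  qed
  then show "\<exists>N. complementary (M + cspan {v}) N" by blast
qed

text \<open>With \<open>C\<close> a complement of \<open>R \<inter> K\<close> and \<open>F\<close> a finite-dimensional complement of \<open>R + K\<close>, a complement
  of \<open>R\<close> is \<open>(K \<inter> C) + F\<close>.\<close>

lemma complementary_if_Int_complementary:
  assumes R: "csubspace R" "operator_range R" and K: "csubspace K" "operator_range K"
    and fin: "finite_modulo UNIV (R + K)" and compl: "complementary (R \<inter> K) C"
  shows "\<exists>N. complementary R N"
proof -
  have C: "csubspace C" "operator_range C"
    using compl by (simp_all add: complementary_def)
  have RK: "csubspace (R + K)" by (intro csubspace_plus R K)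
  obtain F where F: "csubspace F" "operator_range F" "(R + K) \<inter> F = {0}" "(R + K) + F = UNIV"
    using complement_in_finite_extension[OF fin RK complex_vector.subspace_UNIV] by blast
  have "complementary R ((K \<inter> C) + F)"
  proof (rule complementaryI)
    show "csubspace ((K \<inter> C) + F)"
      by (intro csubspace_plus complex_vector.subspace_inter K C F)
    show "operator_range ((K \<inter> C) + F)"
      by (intro operator_range_plus operator_range_Int K C F)
  next
    fix x assume x: "x \<in> R" "x \<in> (K \<inter> C) + F"
    then obtain k f where kf: "k \<in> K" "k \<in> C" "f \<in> F" "x = k + f"
      by (auto elim!: csubspace_plusE)
    have "x + - k \<in> R + K"
      using x(1) kf(1) K(1) by (intro set_plus_intro complex_vector.subspace_neg)
    then have "f \<in> (R + K) \<inter> F" using kf by simp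
    then have "x = k" using F(3) kf(4) by simp
    then show "x = 0"
      using complementary_zeroD[OF compl, of x] x(1) kf by simp
  next
    fix x
    have "x \<in> (R + K) + F" using F(4) by simp
    then obtain r k f where x: "r \<in> R" "k \<in> K" "f \<in> F" "x = (r + k) + f"
      by (auto elim!: csubspace_plusE)
    obtain a c where k: "a \<in> R \<inter> K" "c \<in> C" "k = a + c"
      using complementary_sumE[OF compl] by blast
    have "k - a \<in> K"
      using x(2) k(1) by (intro complex_vector.subspace_diff[OF K(1)]) auto
    then have "(r + a) + (c + f) \<in> R + ((K \<inter> C) + F)"
      using x k by (intro set_plus_intro complex_vector.subspace_add[OF R(1)]) auto
    then show "x \<in> R + ((K \<inter> C) + F)"
      by (simp add: x(4) k(3) algebra_simps)
  qed (use R in auto)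
  then show ?thesis by blast
qed

section \<open>Kernels and ranges of the powers of an operator\<close>

lemma bounded_clinear_bounded_linear:
  assumes "bounded_clinear S"
  shows "bounded_linear S"
proof -
  interpret S: Vector_Spaces.linear scaleC scaleC S
    using assms by (simp add: bounded_clinear_def)
  obtain K where K: "\<And>x. norm (S x) \<le> K * norm x"
    using assms unfolding bounded_clinear_def by blast
  show ?thesis
  proof (rule bounded_linear_intro[of _ K])
    show "S (x + y) = S x + S y" for x y
      by (rule S.add)
    show "S (r *\<^sub>R x) = r *\<^sub>R S x" for r x
      unfolding scaleC_of_real[symmetric] by (rule S.scale)
    show "norm (S x) \<le> norm x * K" for x
      using K[of x] by (simp only: mult.commute)
  qed
qed

lemma bounded_clinear_id: "bounded_clinear (id :: 'a::complex_banach \<Rightarrow> 'a)"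
  unfolding bounded_clinear_def
proof
  show "Vector_Spaces.linear scaleC scaleC (id :: 'a \<Rightarrow> 'a)"
    by (rule complex_vector.linear_id)
  show "\<exists>K. \<forall>x::'a. norm (id x) \<le> K * norm x"
    by (intro exI[of _ 1]) simp
qed

lemma bounded_clinear_comp:
  assumes "bounded_clinear S" "bounded_clinear T"
  shows "bounded_clinear (S \<circ> T)"
  unfolding bounded_clinear_def
proof
  show "Vector_Spaces.linear scaleC scaleC (S \<circ> T)"
    using assms by (intro Vector_Spaces.linear_compose) (auto simp: bounded_clinear_def)
  have "bounded_linear (\<lambda>x. S (T x))"
    using bounded_linear_compose assms[THEN bounded_clinear_bounded_linear] .
  then obtain K where "\<And>x. norm (S (T x)) \<le> norm x * K"
    using bounded_linear.bounded by blast
  then have "norm ((S \<circ> T) x) \<le> K * norm x" for x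
    by (simp add: mult.commute)
  then show "\<exists>K. \<forall>x. norm ((S \<circ> T) x) \<le> K * norm x"
    by blast
qed

lemma bounded_clinear_funpow: "bounded_clinear T \<Longrightarrow> bounded_clinear (T ^^ n)"
  by (induction n) (simp_all add: bounded_clinear_id bounded_clinear_comp)

locale bounded_operator =
  fixes S :: "'a::complex_banach \<Rightarrow> 'a"
  assumes bounded_clinear: "bounded_clinear S"
begin

sublocale Vector_Spaces.linear scaleC scaleC S
  using bounded_clinear by (simp add: bounded_clinear_def)

lemma bounded_linear: "bounded_linear S"
  using bounded_clinear by (rule bounded_clinear_bounded_linear)

lemma csubspace_image: "csubspace M \<Longrightarrow> csubspace (S ` M)"
  by (rule subspace_image[folded csubspace_def])

lemma csubspace_vimage: "csubspace M \<Longrightarrow> csubspace (S -` M)"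
  by (rule subspace_vimage[folded csubspace_def])

lemma csubspace_range: "csubspace (range S)"
  by (rule csubspace_image) simp

lemma csubspace_kernel: "csubspace (kernel S)"
  unfolding kernel_def by (rule subspace_kernel[folded csubspace_def])

lemma operator_range_range: "operator_range (range S)"
  by (intro operator_range_image bounded_linear operator_range_UNIV)

lemma operator_range_kernel: "operator_range (kernel S)"
proof -
  have "kernel S = S -` {0}" by (auto simp: kernel_def)
  then show ?thesis
    by (simp add: operator_range_vimage bounded_linear operator_range_zero)
qed

lemma image_plus: "S ` (M + N) = S ` M + S ` N"
  by (force simp: set_plus_def add)

lemma finite_modulo_image:
  assumes "finite_modulo L M"
  shows "finite_modulo (S ` L) (S ` M)"
proof -
  obtain B where "finite B" and B: "L \<subseteq> M + cspan B"
    using assms unfolding finite_modulo_def by blast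
  have "S ` L \<subseteq> S ` M + cspan (S ` B)"
    using image_mono[OF B, of S] by (simp add: image_plus span_image[folded cspan_def])
  then show ?thesis
    unfolding finite_modulo_def using \<open>finite B\<close> by blast
qed

end

locale bounded_operator_powers =
  fixes T :: "'a::complex_banach \<Rightarrow> 'a"
  assumes T: "bounded_clinear T"
begin

sublocale T: bounded_operator T
  by standard (rule T)

sublocale power: bounded_operator "T ^^ n" for n
  by standard (intro bounded_clinear_funpow T)

abbreviation R :: "nat \<Rightarrow> 'a set"
  where "R n \<equiv> range (T ^^ n)"

abbreviation K :: "nat \<Rightarrow> 'a set"
  where "K n \<equiv> kernel (T ^^ n)"

lemma power_apply_add: "(T ^^ (m + n)) x = (T ^^ m) ((T ^^ n) x)"
  by (simp add: funpow_add)

lemma range_antimono: "m \<le> n \<Longrightarrow> R n \<subseteq> R m"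
  by (metis image_subsetI le_add_diff_inverse power_apply_add rangeI)

lemma kernel_mono:
  assumes "m \<le> n"
  shows "K m \<subseteq> K n"
proof -
  have "(T ^^ n) x = (T ^^ (n - m)) ((T ^^ m) x)" for x
    using power_apply_add[of "n - m" m x] assms by simp
  then show ?thesis
    by (auto simp: kernel_def power.zero)
qed

lemma kernel_invariant: "x \<in> K n \<Longrightarrow> (T ^^ m) x \<in> K n"
  using power_apply_add[of m n x] power_apply_add[of n m x]
  by (simp add: kernel_def power.zero add.commute)

text \<open>The operator \<open>T\<^bsup>m\<^esup>\<close> maps \<open>R(T) + N(T\<^bsup>n\<^esup>)\<close> into \<open>R(T\<^bsup>m+1\<^esup>)\<close> once \<open>m \<ge> n\<close>, so it carries the finite
  codimension of the former over to the ranges of the powers.\<close>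

lemma finite_modulo_range_Suc:
  assumes fin: "finite_modulo UNIV (range T + K n)" and "n \<le> m"
  shows "finite_modulo (R m) (R (Suc m))"
proof -
  have "(T ^^ m) ` (range T + K n) \<subseteq> R (Suc m)"
  proof
    fix y assume "y \<in> (T ^^ m) ` (range T + K n)"
    then obtain x z where "z \<in> K n" "y = (T ^^ m) (T x + z)"
      by (auto elim!: csubspace_plusE)
    moreover have "z \<in> K m" using kernel_mono[OF \<open>n \<le> m\<close>] \<open>z \<in> K n\<close> by blast
    ultimately have "y = (T ^^ Suc m) x"
      by (simp add: power.add kernel_def funpow_swap1)
    then show "y \<in> R (Suc m)" by blast
  qed
  then show ?thesis
    using power.finite_modulo_image[OF fin, of m] finite_modulo_mono by blast
qed

lemma finite_modulo_range:
  assumes fin: "finite_modulo UNIV (range T + K n)" and "n \<le> m" and "m \<le> q"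
  shows "finite_modulo (R m) (R q)"
  using \<open>m \<le> q\<close>
proof (induction q rule: dec_induct)
  case (step q)
  then show ?case
    using finite_modulo_range_Suc[OF fin, of q] \<open>n \<le> m\<close> finite_modulo_trans by (meson le_trans)
qed (simp add: finite_modulo_subset)

lemma finite_modulo_range_plus_kernel:
  assumes fin: "finite_modulo UNIV (range T + K n)"
  shows "finite_modulo UNIV (R j + K n)"
proof (induction j)
  case 0
  then show ?case
    by (intro finite_modulo_subset) (auto intro!: subset_plus_left[THEN subsetD] power.csubspace_kernel)
next
  case (Suc j)
  have "(T ^^ j) ` (range T + K n) \<subseteq> R (Suc j) + K n"
  proof
    fix y assume "y \<in> (T ^^ j) ` (range T + K n)"
    then obtain x z where "z \<in> K n" "y = (T ^^ j) (T x + z)"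
      by (auto elim!: csubspace_plusE)
    then have "(T ^^ j) z \<in> K n" "y = (T ^^ Suc j) x + (T ^^ j) z"
      using kernel_invariant by (auto simp: power.add funpow_swap1)
    then show "y \<in> R (Suc j) + K n" by blast
  qed
  then have "finite_modulo (R j) (R (Suc j) + K n)"
    using power.finite_modulo_image[OF fin, of j] finite_modulo_mono by blast
  then have "finite_modulo (R j + K n) ((R (Suc j) + K n) + K n)"
    by (rule finite_modulo_plus)
  moreover have "(R (Suc j) + K n) + K n \<subseteq> R (Suc j) + K n"
    by (intro plus_subset_csubspace csubspace_plus power.csubspace_range power.csubspace_kernel
        order_refl subset_plus_right)
  ultimately show ?case
    using Suc.IH finite_modulo_trans finite_modulo_mono by blast
qed

text \<open>The increasing subspaces \<open>R(T) + N(T\<^bsup>n\<^esup>)\<close> have finite codimension from \<open>d\<close> on, hence are eventually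
  constant; and an equality between two consecutive ones says that \<open>N(T) \<inter> R(T\<^bsup>n\<^esup>)\<close> is contained in
  \<open>R(T\<^bsup>n+1\<^esup>)\<close>.\<close>

lemma kernel_Int_range_stabilizes:
  assumes fin: "finite_modulo UNIV (range T + K d)"
  obtains k where "\<And>n. n \<ge> k \<Longrightarrow> kernel T \<inter> R n = kernel T \<inter> R k"
proof -
  obtain k where k: "\<And>n. n \<ge> k \<Longrightarrow> range T + K n = range T + K k"
  proof (rule finite_modulo_chain_stabilizes[of "\<lambda>n. range T + K n" d])
    show "csubspace (range T + K n)" for n
      by (intro csubspace_plus T.csubspace_range power.csubspace_kernel)
    show "range T + K m \<subseteq> range T + K n" if "m \<le> n" for m n
      using kernel_mono[OF that] by (rule set_plus_mono2[OF order_refl])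
    show "finite_modulo (\<Union>n. range T + K n) (range T + K d)"
      using finite_modulo_mono[OF fin subset_UNIV order_refl] .
  qed (use that in blast)
  have step: "kernel T \<inter> R n \<subseteq> R (Suc n)" if "n \<ge> k" for n
  proof
    fix y assume y: "y \<in> kernel T \<inter> R n"
    then obtain x where x: "y = (T ^^ n) x" by blast
    then have "x \<in> K (Suc n)" using y by (simp add: kernel_def)
    then have "x \<in> range T + K (Suc n)"
      using subset_plus_right[OF T.csubspace_range] by blast
    also have "range T + K (Suc n) = range T + K n"
      using k[of n] k[of "Suc n"] that by simp
    finally obtain z u where "u \<in> K n" "x = T z + u"
      by (auto elim!: csubspace_plusE)
    then have "y = (T ^^ Suc n) z"
      by (simp add: x power.add kernel_def funpow_swap1)
    then show "y \<in> R (Suc n)" by blast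
  qed
  have Suc_eq: "kernel T \<inter> R (Suc n) = kernel T \<inter> R n" if "n \<ge> k" for n
  proof
    show "kernel T \<inter> R (Suc n) \<subseteq> kernel T \<inter> R n"
      using range_antimono[of n "Suc n"] by (intro Int_mono) auto
    show "kernel T \<inter> R n \<subseteq> kernel T \<inter> R (Suc n)"
      by (intro Int_greatest Int_lower1 step that)
  qed
  have "kernel T \<inter> R n = kernel T \<inter> R k" if "n \<ge> k" for n
    using that
  proof (induction n rule: dec_induct)
    case (step n)
    then show ?case using Suc_eq[of n] by simp
  qed simp
  then show thesis using that by blast
qed

text \<open>From kernels of \<open>T\<close> to kernels of its powers. The operator \<open>T\<close> maps \<open>N(T\<^bsup>j+1\<^esup>) \<inter> R(T\<^bsup>m\<^esup>)\<close> onto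
  \<open>N(T\<^bsup>j\<^esup>) \<inter> R(T\<^bsup>m+1\<^esup>)\<close> with kernel \<open>N(T) \<inter> R(T\<^bsup>m\<^esup>)\<close>. If \<open>N\<close> is a complement of the image and \<open>N0\<close> one
  of the kernel, then \<open>T\<^bsup>-1\<^esup>(N) \<inter> N0\<close> is a complement of the domain.\<close>

lemma kernel_power_Int_range_complementary:
  assumes "\<And>m. m \<ge> d \<Longrightarrow> \<exists>N. complementary (kernel T \<inter> R m) N" and "m \<ge> d"
  shows "\<exists>N. complementary (K j \<inter> R m) N"
  using \<open>m \<ge> d\<close>
proof (induction j arbitrary: m)
  case 0
  have "K 0 \<inter> R m = {0}"
    using complex_vector.subspace_0[OF power.csubspace_range[of m]] by (auto simp: kernel_def)
  moreover have "complementary {0 :: 'a} UNIV"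
    by (rule complementaryI) (auto simp: operator_range_zero operator_range_UNIV)
  ultimately show ?case by metis
next
  case (Suc j)
  obtain N0 where N0: "complementary (kernel T \<inter> R m) N0"
    using assms(1)[OF Suc.prems] by blast
  obtain N where N: "complementary (K j \<inter> R (Suc m)) N"
    using Suc.IH[of "Suc m"] Suc.prems by auto
  have sub: "csubspace N0" "csubspace N" "operator_range N0" "operator_range N"
    using N0 N by (simp_all add: complementary_def)
  have Suc_mem: "T x \<in> K j \<inter> R (Suc m)" if "x \<in> K (Suc j) \<inter> R m" for x
    using that by (auto simp: kernel_def funpow_swap1)
  have subset: "kernel T \<inter> R m \<subseteq> K (Suc j) \<inter> R m"
    using kernel_mono[of 1 "Suc j"] by auto
  have sub': "csubspace (K (Suc j) \<inter> R m)"
    by (intro complex_vector.subspace_inter power.csubspace_kernel power.csubspace_range)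
  have "complementary (K (Suc j) \<inter> R m) (T -` N \<inter> N0)"
  proof (rule complementaryI)
    show "csubspace (K (Suc j) \<inter> R m)" by (fact sub')
    show "csubspace (T -` N \<inter> N0)"
      by (intro complex_vector.subspace_inter T.csubspace_vimage sub)
    show "operator_range (K (Suc j) \<inter> R m)"
      by (intro operator_range_Int power.operator_range_kernel power.operator_range_range)
    show "operator_range (T -` N \<inter> N0)"
      by (intro operator_range_Int operator_range_vimage T.bounded_linear sub)
  next
    fix x assume x: "x \<in> K (Suc j) \<inter> R m" "x \<in> T -` N \<inter> N0"
    then have "T x = 0"
      using complementary_zeroD[OF N Suc_mem[OF x(1)]] by simp
    then show "x = 0"
      using complementary_zeroD[OF N0, of x] x by (simp add: kernel_def)
  next
    fix x
    \<comment> \<open>Lift the \<open>K j\<close>-component of \<open>T x\<close> to \<open>w\<close>, and split the remainder \<open>x - w\<close> along \<open>N0\<close>.\<close>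
    obtain a b where ab: "a \<in> K j \<inter> R (Suc m)" "b \<in> N" "T x = a + b"
      using complementary_sumE[OF N] by blast
    then obtain z where "a = T ((T ^^ m) z)" by auto
    define w where "w = (T ^^ m) z"
    have w: "T w = a" "w \<in> R m"
      by (auto simp: w_def \<open>a = _\<close>)
    then have "w \<in> K (Suc j)"
      using ab(1) by (simp add: kernel_def funpow_swap1)
    obtain c n where cn: "c \<in> kernel T \<inter> R m" "n \<in> N0" "x - w = c + n"
      using complementary_sumE[OF N0] by blast
    have "T (x - w) = T c + T n"
      by (simp add: cn(3) T.add)
    then have "T n = b"
      using cn(1) ab(3) w(1) by (simp add: kernel_def T.diff)
    then have "n \<in> T -` N \<inter> N0" using ab cn by simp
    moreover have "w + c \<in> K (Suc j) \<inter> R m"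
      using \<open>w \<in> K (Suc j)\<close> w(2) cn(1) subset by (intro complex_vector.subspace_add[OF sub']) auto
    moreover have "x = (w + c) + n"
      using cn(3) by (simp add: algebra_simps)
    ultimately show "x \<in> (K (Suc j) \<inter> R m) + (T -` N \<inter> N0)"
      by blast
  qed
  then show ?case by blast
qed

lemma kernel_range_complementary:
  assumes fin: "finite_modulo UNIV (range T + K n)"
    and compl: "\<And>m. m \<ge> n \<Longrightarrow> \<exists>N. complementary (kernel T \<inter> R m) N"
  shows "\<exists>N. complementary (K n) N" "\<exists>N. complementary (R n) N"
proof -
  obtain C where C: "complementary (K n \<inter> R n) C"
    using kernel_power_Int_range_complementary[OF compl] by blast
  have fin': "finite_modulo UNIV (R n + K n)"
    using fin by (rule finite_modulo_range_plus_kernel)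
  note facts = power.csubspace_kernel power.operator_range_kernel
    power.csubspace_range power.operator_range_range
  show "\<exists>N. complementary (K n) N"
    using fin' C by (intro complementary_if_Int_complementary[of "K n" "R n" C] facts)
      (simp_all add: add.commute)
  show "\<exists>N. complementary (R n) N"
    using fin' C by (intro complementary_if_Int_complementary[of "R n" "K n" C] facts)
      (simp_all add: Int_commute)
qed

text \<open>The operator \<open>T\<^bsup>n\<^esup>\<close> maps \<open>N(T\<^bsup>n+1\<^esup>)\<close> onto \<open>N(T) \<inter> R(T\<^bsup>n\<^esup>)\<close>, and its kernel lies in \<open>N(T\<^bsup>n+1\<^esup>)\<close>. So the
  image of a complement \<open>D\<close> of \<open>N(T\<^bsup>n+1\<^esup>)\<close> complements \<open>N(T) \<inter> R(T\<^bsup>n\<^esup>)\<close> within \<open>R(T\<^bsup>n\<^esup>)\<close>.\<close>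

lemma kernel_Int_range_complementary:
  assumes K: "complementary (K (Suc n)) D" and R: "complementary (R n) C"
  shows "\<exists>N. complementary (kernel T \<inter> R n) N"
proof -
  have sub: "csubspace D" "operator_range D" "csubspace C" "operator_range C"
    using K R by (simp_all add: complementary_def)
  have "complementary (kernel T \<inter> R n) ((T ^^ n) ` D + C)"
  proof (rule complementaryI)
    show "csubspace (kernel T \<inter> R n)"
      by (intro complex_vector.subspace_inter T.csubspace_kernel power.csubspace_range)
    show "operator_range (kernel T \<inter> R n)"
      by (intro operator_range_Int T.operator_range_kernel power.operator_range_range)
    show "csubspace ((T ^^ n) ` D + C)"
      by (intro csubspace_plus power.csubspace_image sub)
    show "operator_range ((T ^^ n) ` D + C)"
      by (intro operator_range_plus operator_range_image power.bounded_linear sub)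
  next
    fix x assume x: "x \<in> kernel T \<inter> R n" "x \<in> (T ^^ n) ` D + C"
    then obtain d c where dc: "d \<in> D" "c \<in> C" "x = (T ^^ n) d + c"
      by (auto elim!: csubspace_plusE)
    have "x - (T ^^ n) d \<in> R n"
      using x by (intro complex_vector.subspace_diff[OF power.csubspace_range]) auto
    then have "c = 0"
      using complementary_zeroD[OF R, of c] dc by simp
    then have "d \<in> K (Suc n)"
      using x(1) dc(3) by (simp add: kernel_def)
    then have "d = 0"
      using complementary_zeroD[OF K] dc(1) by blast
    then show "x = 0"
      using dc(3) \<open>c = 0\<close> by (simp add: power.zero)
  next
    fix x
    obtain r c where rc: "r \<in> R n" "c \<in> C" "x = r + c"
      using complementary_sumE[OF R] by blast
    then obtain y where y: "r = (T ^^ n) y" by blast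
    obtain k d where kd: "k \<in> K (Suc n)" "d \<in> D" "y = k + d"
      using complementary_sumE[OF K] by blast
    have "(T ^^ n) k + ((T ^^ n) d + c) \<in> kernel T \<inter> R n + ((T ^^ n) ` D + C)"
      using kd rc(2) by (intro set_plus_intro) (auto simp: kernel_def)
    then show "x \<in> kernel T \<inter> R n + ((T ^^ n) ` D + C)"
      by (simp add: rc(3) y kd(3) power.add add.assoc)
  qed
  then show ?thesis by blast
qed

end

section \<open>Essential descent and degree of stable iteration\<close>

lemma codim_finite_iff:
  assumes M: "csubspace M"
  shows "codim M < \<infinity> \<longleftrightarrow> finite_modulo UNIV M"
proof -
  have "(\<exists>y\<in>cspan B. x - y \<in> M) \<longleftrightarrow> x \<in> M + cspan B" for x B
  proof
    assume "\<exists>y\<in>cspan B. x - y \<in> M"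
    then obtain y where "y \<in> cspan B" "x - y \<in> M" by blast
    then have "(x - y) + y \<in> M + cspan B" by blast
    then show "x \<in> M + cspan B" by simp
  qed (force elim: csubspace_plusE)
  then have "finite_modulo UNIV M \<longleftrightarrow> (\<exists>B. finite B \<and> (\<forall>x. \<exists>y\<in>cspan B. x - y \<in> M))"
    unfolding finite_modulo_def by (simp add: subset_eq)
  moreover have "codim M < \<infinity> \<longleftrightarrow> (\<exists>B. finite B \<and> (\<forall>x. \<exists>y\<in>cspan B. x - y \<in> M))"
    unfolding codim_def Inf_less_iff by auto
  ultimately show ?thesis by simp
qed

lemma Inf_enat_attained:
  assumes "Inf {enat n |n. P n} < \<infinity>"
  obtains n where "Inf {enat n |n. P n} = enat n" "P n"
proof -
  let ?A = "{enat n |n. P n}"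
  have "?A \<noteq> {}"
  proof
    assume "?A = {}"
    then have "Inf ?A = \<infinity>" unfolding Inf_enat_def by (rule if_P)
    then show False using assms by simp
  qed
  then obtain x where "x \<in> ?A" by blast
  then have "(LEAST x. x \<in> ?A) \<in> ?A" by (rule LeastI)
  then have "Inf ?A \<in> ?A"
    using \<open>?A \<noteq> {}\<close> unfolding Inf_enat_def by (simp only: if_False)
  then show thesis using that by blast
qed

context bounded_operator_powers
begin

lemma codim_range_plus_kernel: "codim (range T + K n) < \<infinity> \<longleftrightarrow> finite_modulo UNIV (range T + K n)"
  by (intro codim_finite_iff csubspace_plus T.csubspace_range power.csubspace_kernel)

lemma essential_descent_finiteE:
  assumes "essential_descent T < \<infinity>"
  obtains d where "essential_descent T = enat d" "finite_modulo UNIV (range T + K d)"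
  using assms unfolding essential_descent_def codim_range_plus_kernel
  by (rule Inf_enat_attained)

lemma finite_modulo_above_essential_descent:
  assumes "essential_descent T \<le> enat n"
  shows "finite_modulo UNIV (range T + K n)"
proof -
  have "essential_descent T < \<infinity>"
    using assms by (rule le_less_trans) simp
  then obtain d where d: "essential_descent T = enat d" "finite_modulo UNIV (range T + K d)"
    by (rule essential_descent_finiteE)
  have "range T + K d \<subseteq> range T + K n"
    using assms d(1) by (intro set_plus_mono2 kernel_mono) auto
  then show ?thesis
    using finite_modulo_mono[OF d(2)] by blast
qed

lemma dis_stable:
  assumes "dis T = enat k" "m \<ge> k"
  shows "kernel T \<inter> R m = kernel T \<inter> R k"
proof -
  have "dis T < \<infinity>" using assms by simp
  then obtain k' where "dis T = enat k'"
    and k': "\<forall>m. m \<ge> k' \<and> m \<ge> 1 \<longrightarrow> kernel T \<inter> R k' = kernel T \<inter> R m"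
    unfolding dis_def by (rule Inf_enat_attained)
  then have "k' = k" using assms(1) by simp
  show ?thesis
  proof (cases "m = k")
    case False
    then have "m \<ge> k' \<and> m \<ge> 1" using assms(2) \<open>k' = k\<close> by simp
    then have "kernel T \<inter> R k' = kernel T \<inter> R m" using k' by blast
    then show ?thesis using \<open>k' = k\<close> by simp
  qed simp
qed

lemma dis_finite:
  assumes "finite_modulo UNIV (range T + K d)"
  obtains k where "dis T = enat k"
proof -
  obtain k where k: "\<And>n. n \<ge> k \<Longrightarrow> kernel T \<inter> R n = kernel T \<inter> R k"
    using kernel_Int_range_stabilizes[OF assms] by blast
  have "\<forall>m. m \<ge> k \<and> m \<ge> 1 \<longrightarrow> kernel T \<inter> R k = kernel T \<inter> R m"
    by (intro allI impI k[symmetric]) (elim conjE)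
  then have "enat k \<in> {enat n |n. \<forall>m. m \<ge> n \<and> m \<ge> 1 \<longrightarrow> kernel T \<inter> R n = kernel T \<inter> R m}"
    by blast
  then have "dis T \<le> enat k"
    unfolding dis_def by (rule Inf_lower)
  then show thesis using that by (cases "dis T") auto
qed

text \<open>From \<open>dis T\<close> on, the subspaces \<open>N(T) \<inter> R(T\<^bsup>n\<^esup>)\<close> are constant; between the essential descent and
  \<open>dis T\<close> they change by finitely many dimensions only, which does not affect complementation.\<close>

lemma kernel_Int_range_complementary_transfer:
  assumes fin: "finite_modulo UNIV (range T + K d)" and "dis T = enat k" and "d \<le> n"
  shows "(\<exists>N. complementary (kernel T \<inter> R n) N) \<longleftrightarrow> (\<exists>N. complementary (kernel T \<inter> R k) N)"
proof (cases "k \<le> n")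
  case True
  show ?thesis unfolding dis_stable[OF assms(2) True] by (rule refl)
next
  case False
  have sub: "csubspace (kernel T \<inter> R m)" "operator_range (kernel T \<inter> R m)" for m
    by (intro complex_vector.subspace_inter operator_range_Int T.csubspace_kernel
        power.csubspace_range T.operator_range_kernel power.operator_range_range)+
  have RR: "R k \<subseteq> R n" using False by (intro range_antimono) simp
  have "finite_modulo (R n \<inter> kernel T) (R k \<inter> kernel T)"
    using finite_modulo_range[OF fin \<open>d \<le> n\<close>, of k] False RR
    by (intro finite_modulo_Int power.csubspace_range T.csubspace_kernel) auto
  then have "finite_modulo (kernel T \<inter> R n) (kernel T \<inter> R k)"
    by (simp add: Int_commute)
  moreover have "kernel T \<inter> R k \<subseteq> kernel T \<inter> R n" using RR by blast
  ultimately show ?thesis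
    using complementary_finite_restriction[OF _ _ sub] complementary_finite_extension[OF _ _ sub(1)]
    by blast
qed

end

section \<open>Essentially right Drazin invertible operators\<close>

theorem theorem3p6:
  fixes T :: "'a::complex_banach \<Rightarrow> 'a"
  assumes "infinite_cdim TYPE('a)"
    and "bounded_clinear T"
  defines "i \<equiv> essentially_right_Drazin_invertible T"
    and "ii \<equiv> essential_descent T < \<infinity> \<and>
      (\<forall>n. enat n \<ge> essential_descent T \<longrightarrow>
        topologically_complemented (kernel (T ^^ n)) \<and> topologically_complemented (range (T ^^ n)))"
    and "iii \<equiv> essential_descent T < \<infinity> \<and>
      (\<exists>n. enat n \<ge> essential_descent T \<and>
        topologically_complemented (kernel (T ^^ (n + 1))) \<and> topologically_complemented (range (T ^^ n)))"
  shows "(i \<longleftrightarrow> ii) \<and> (ii \<longleftrightarrow> iii)"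
proof -
  interpret bounded_operator_powers T
    by standard fact
  have "i \<Longrightarrow> ii"
  proof -
    assume i
    then obtain k where fin: "essential_descent T < \<infinity>" and k: "dis T = enat k"
      and compl: "\<exists>N. complementary (kernel T \<inter> R k) N"
      unfolding i_def essentially_right_Drazin_invertible_def topologically_complemented_iff by blast
    have "topologically_complemented (K n) \<and> topologically_complemented (R n)"
      if n: "essential_descent T \<le> enat n" for n
    proof -
      have n': "finite_modulo UNIV (range T + K n)"
        using n by (rule finite_modulo_above_essential_descent)
      then have "\<exists>N. complementary (kernel T \<inter> R m) N" if "m \<ge> n" for m
        using kernel_Int_range_complementary_transfer[OF n' k that] compl by blast
      then show ?thesis
        unfolding topologically_complemented_iff using kernel_range_complementary[OF n'] by blast
    qed
    then show ii unfolding ii_def using fin by blast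
  qed
  moreover have "ii \<Longrightarrow> iii"
  proof -
    assume ii: ii
    then obtain d where d: "essential_descent T = enat d"
      unfolding ii_def by (auto elim: essential_descent_finiteE)
    have "topologically_complemented (K (d + 1))" "topologically_complemented (R d)"
      using ii d unfolding ii_def by (simp_all del: funpow.simps)
    then show iii
      unfolding iii_def using ii d by (auto simp: ii_def intro!: exI[of _ d])
  qed
  moreover have "iii \<Longrightarrow> i"
  proof -
    assume iii
    then obtain n where fin: "essential_descent T < \<infinity>" and n: "essential_descent T \<le> enat n"
      and compl: "\<exists>N. complementary (K (Suc n)) N" "\<exists>N. complementary (R n) N"
      unfolding iii_def topologically_complemented_iff by auto
    have n': "finite_modulo UNIV (range T + K n)"
      using n by (rule finite_modulo_above_essential_descent)
    then obtain k where k: "dis T = enat k"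
      by (rule dis_finite)
    have "\<exists>N. complementary (kernel T \<inter> R k) N"
      using kernel_Int_range_complementary compl
        kernel_Int_range_complementary_transfer[OF n' k order_refl] by blast
    then show i
      unfolding i_def essentially_right_Drazin_invertible_def topologically_complemented_iff
      using fin k by blast
  qed
  ultimately show ?thesis by blast
qed

end
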